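(* (Law of large numbers.) Let $\{Y_i\}_{i=1}^{\infty}$ be a sequence of $\mathbb{R}^d$-valued random vectors on a sublinear expectation space $(\Omega,\mathcal{H},\mathbb{E})$. Assume that, for each $i=1,2,\dots$, $Y_{i+1}\overset{d}{=}Y_i$ and $Y_{i+1}$ is independent from $(Y_1,\dots,Y_i)$. Put $\bar S_n:=\frac1n\sum_{i=1}^n Y_i$. Then $\{\bar S_n\}$ converges in law to a maximal distribution, in the sense that $$\lim_{n\to\infty}\mathbb{E}[\varphi(\bar S_n)]=\mathbb{E}[\varphi(\eta)]$$ for all $\varphi\in C(\mathbb{R}^d)$ satisfying the linear growth condition $|\varphi(x)|\le C(1+|x|)$, where $\eta$ is a maximal distributed random vector whose associated sublinear function $p\mapsto \mathbb{E}[\langle p,\eta\rangle]$ is $g:\mathbb{R}^d\to\mathbb{R}$, $g(p):=\mathbb{E}[\langle p,Y_1\rangle]$.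
   Context: $C_{l.Lip}(\mathbb{R}^n)$ is the space of functions $\varphi:\mathbb{R}^n\to\mathbb{R}$ with $|\varphi(x)-\varphi(y)|\le C(1+|x|^m+|y|^m)|x-y|$ for some $C>0$, $m\in\mathbb{N}$ depending on $\varphi$. Sublinear expectation space $(\Omega,\mathcal{H},\mathbb{E})$: $\Omega$ is a set; $\mathcal{H}$ is a linear space of real functions on $\Omega$ containing the constants, with $|X|\in\mathcal{H}$ if $X\in\mathcal{H}$, and $\varphi(X_1,\dots,X_n)\in\mathcal{H}$ whenever $X_1,\dots,X_n\in\mathcal{H}$ and $\varphi\in C_{l.Lip}(\mathbb{R}^n)$; $\mathbb{E}:\mathcal{H}\to\mathbb{R}$ satisfies: $X\ge Y\Rightarrow\mathbb{E}[X]\ge\mathbb{E}[Y]$; $\mathbb{E}[c]=c$ for $c\in\mathbb{R}$; $\mathbb{E}[X+Y]\le\mathbb{E}[X]+\mathbb{E}[Y]$; $\mathbb{E}[\lambda X]=\lambda\mathbb{E}[X]$ for $\lambda\ge0$. An $n$-dimensional random vector is an element of $\mathcal{H}^n$. Two $n$-dimensional random vectors $X_1,X_2$ on sublinear expectation spaces with expectations $\mathbb{E}_1,\mathbb{E}_2$ are identically distributed, $X_1\overset{d}{=}X_2$, if $\mathbb{E}_1[\varphi(X_1)]=\mathbb{E}_2[\varphi(X_2)]$ for all $\varphi\in C_{l.Lip}(\mathbb{R}^n)$. $Y\in\mathcal{H}^n$ is independent from $X\in\mathcal{H}^m$ if $\mathbb{E}[\varphi(X,Y)]=\mathbb{E}[\mathbb{E}[\varphi(x,Y)]_{x=X}]$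 for all $\varphi\in C_{l.Lip}(\mathbb{R}^{m+n})$. A $d$-dimensional random vector $\eta$ is maximal distributed if there is a bounded, closed, convex set $\Gamma\subset\mathbb{R}^d$ with $\mathbb{E}[\varphi(\eta)]=\max_{y\in\Gamma}\varphi(y)$ for all $\varphi\in C_{l.Lip}(\mathbb{R}^d)$; its law is determined by $p\mapsto\mathbb{E}[\langle p,\eta\rangle]=\sup_{q\in\Gamma}\langle p,q\rangle$. Standing assumption: the space $(\Omega,\mathcal{H},\mathbb{E})$ carries the vector $\eta$ in question (otherwise $\mathbb{E}[\varphi(\eta)]$ is read on another sublinear expectation space carrying $\eta$). Convention: for $X\in\mathcal{H}^d$ and $\varphi$ continuous of linear growth, $\mathbb{E}[\varphi(X)]$ is the value of the continuous extension of $\mathbb{E}$ to the completion of $\mathcal{H}$ (modulo null elements) under $\mathbb{E}[|\cdot|]$; that is, $\mathbb{E}[\varphi(X)]=\lim_k\mathbb{E}[\varphi_k(X)]$ for any $\varphi_k\in C_{l.Lip}(\mathbb{R}^d)$ such that $|\varphi-\varphi_k|\le\psi_k$ with $\psi_k\in C_{l.Lip}(\mathbb{R}^d)$ and $\mathbb{E}[\psi_k(X)]\to0$. *)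

theory Defs
  imports "HOL-Analysis.Analysis"
begin

definition C_lLip :: "('a::euclidean_space \<Rightarrow> real) set" where
  "C_lLip = {\<phi>. \<exists>C>0. \<exists>m::nat. \<forall>x y.
     \<bar>\<phi> x - \<phi> y\<bar> \<le> C * (1 + norm x ^ m + norm y ^ m) * norm (x - y)}"

text \<open>
  The same class for a dimension that is not fixed by a type: for a finite index set \<open>I\<close>, a
  function on the Euclidean space of \<open>I\<close>-tuples is represented by a function of
  \<open>x :: 'i \<Rightarrow> real\<close>, with Euclidean norm \<open>L2_set x I\<close>. The growth condition forces such a
  function to ignore the coordinates outside \<open>I\<close> (see \<open>C_lLip_on_cong\<close>), so no separate
  condition is needed. The two versions agree by \<open>C_lLip_iff_on\<close>.
\<close>

definition C_lLip_on :: "'i set \<Rightarrow> (('i \<Rightarrow> real) \<Rightarrow> real) set" where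
  "C_lLip_on I = {\<phi>. \<exists>C>0. \<exists>m::nat. \<forall>x y.
     \<bar>\<phi> x - \<phi> y\<bar> \<le> C * (1 + L2_set x I ^ m + L2_set y I ^ m) * L2_set (\<lambda>i. x i - y i) I}"

lemma C_lLip_on_cong:
  assumes "\<phi> \<in> C_lLip_on I" and "\<And>i. i \<in> I \<Longrightarrow> x i = y i"
  shows "\<phi> x = \<phi> y"
proof -
  have "L2_set (\<lambda>i. x i - y i) I = L2_set (\<lambda>i. 0) I"
    using assms(2) by (intro L2_set_cong) auto
  then have "L2_set (\<lambda>i. x i - y i) I = 0"
    by (simp add: L2_set_def)
  moreover obtain C m where "\<bar>\<phi> x - \<phi> y\<bar>
      \<le> C * (1 + L2_set x I ^ m + L2_set y I ^ m) * L2_set (\<lambda>i. x i - y i) I"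
    using assms(1) unfolding C_lLip_on_def by blast
  ultimately show ?thesis
    by simp
qed

lemma C_lLip_iff_on:
  fixes \<phi> :: "real ^ 'd \<Rightarrow> real"
  shows "\<phi> \<in> C_lLip \<longleftrightarrow> (\<lambda>x. \<phi> (\<chi> j. x j)) \<in> C_lLip_on UNIV"
proof -
  have bij: "bij (vec_lambda :: ('d \<Rightarrow> real) \<Rightarrow> real ^ 'd)"
    by (rule bijI') (auto simp: vec_lambda_inject intro: vec_nth_inverse[symmetric])
  have all: "(\<forall>x. P x) \<longleftrightarrow> (\<forall>f. P (vec_lambda f))" for P :: "real ^ 'd \<Rightarrow> bool"
    using bij_is_surj[OF bij] by (metis surjD)
  have n: "norm (vec_lambda x :: real ^ 'd) = L2_set x UNIV" for x
    by (simp add: norm_vec_def L2_set_def)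
  have d: "(vec_lambda x :: real ^ 'd) - vec_lambda y = (\<chi> j. x j - y j)" for x y
    by (simp add: vec_eq_iff)
  have "(\<forall>x y. Q x y) \<longleftrightarrow> (\<forall>f g. Q (vec_lambda f) (vec_lambda g))"
    for Q :: "real ^ 'd \<Rightarrow> real ^ 'd \<Rightarrow> bool"
    using all[of "\<lambda>x. \<forall>y. Q x y"] all[of "Q (vec_lambda f)" for f] by auto
  then show ?thesis
    unfolding C_lLip_def C_lLip_on_def mem_Collect_eq by (simp only: d n)
qed

text \<open>The underlying set of the space is the type \<open>'w\<close>; \<open>E\<close> is only meaningful on \<open>H\<close>.\<close>

locale sublinear_expectation_space =
  fixes H :: "('w \<Rightarrow> real) set" and E :: "('w \<Rightarrow> real) \<Rightarrow> real"
  assumes H_const: "(\<lambda>\<omega>. c) \<in> H"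
    and H_add: "\<lbrakk>X \<in> H; Y \<in> H\<rbrakk> \<Longrightarrow> (\<lambda>\<omega>. X \<omega> + Y \<omega>) \<in> H"
    and H_scale: "X \<in> H \<Longrightarrow> (\<lambda>\<omega>. c * X \<omega>) \<in> H"
    and H_abs: "X \<in> H \<Longrightarrow> (\<lambda>\<omega>. \<bar>X \<omega>\<bar>) \<in> H"
    and H_comp: "\<And>(n::nat) \<phi> Z. \<lbrakk>\<phi> \<in> C_lLip_on {..<n}; \<And>i. i < n \<Longrightarrow> Z i \<in> H\<rbrakk>
                   \<Longrightarrow> (\<lambda>\<omega>. \<phi> (\<lambda>i. Z i \<omega>)) \<in> H"
    and E_mono: "\<lbrakk>X \<in> H; Y \<in> H; \<And>\<omega>. Y \<omega> \<le> X \<omega>\<rbrakk> \<Longrightarrow> E Y \<le> E X"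
    and E_const: "E (\<lambda>\<omega>. c) = c"
    and E_subadd: "\<lbrakk>X \<in> H; Y \<in> H\<rbrakk> \<Longrightarrow> E (\<lambda>\<omega>. X \<omega> + Y \<omega>) \<le> E X + E Y"
    and E_pos_homogeneous: "\<lbrakk>X \<in> H; 0 \<le> c\<rbrakk> \<Longrightarrow> E (\<lambda>\<omega>. c * X \<omega>) = c * E X"

definition random_vector :: "('w \<Rightarrow> real) set \<Rightarrow> ('w \<Rightarrow> real ^ 'd) \<Rightarrow> bool" where
  "random_vector H X \<longleftrightarrow> (\<forall>j. (\<lambda>\<omega>. X \<omega> $ j) \<in> H)"

definition identically_distributed ::
  "(('w \<Rightarrow> real) \<Rightarrow> real) \<Rightarrow> ('w \<Rightarrow> real ^ 'd) \<Rightarrow> (('v \<Rightarrow> real) \<Rightarrow> real) \<Rightarrow> ('v \<Rightarrow> real ^ 'd) \<Rightarrow> bool"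
where
  "identically_distributed E1 X1 E2 X2 \<longleftrightarrow>
     (\<forall>\<phi>\<in>C_lLip. E1 (\<lambda>\<omega>. \<phi> (X1 \<omega>)) = E2 (\<lambda>\<omega>. \<phi> (X2 \<omega>)))"

text \<open>
  \<open>independent_from E J Y I X\<close>: the tuple \<open>Y\<close>, indexed by \<open>J\<close>, is independent from the tuple
  \<open>X\<close>, indexed by \<open>I\<close>. The pair \<open>(X, Y)\<close> is the tuple indexed by the disjoint union \<open>I <+> J\<close>.
  The relation is not symmetric.
\<close>

definition independent_from ::
  "(('w \<Rightarrow> real) \<Rightarrow> real) \<Rightarrow> 'j set \<Rightarrow> ('j \<Rightarrow> 'w \<Rightarrow> real) \<Rightarrow> 'i set \<Rightarrow> ('i \<Rightarrow> 'w \<Rightarrow> real) \<Rightarrow> bool"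
where
  "independent_from E J Y I X \<longleftrightarrow>
     (\<forall>\<phi>\<in>C_lLip_on (I <+> J).
        E (\<lambda>\<omega>. \<phi> (case_sum (\<lambda>i. X i \<omega>) (\<lambda>j. Y j \<omega>))) =
        E (\<lambda>\<omega>. E (\<lambda>\<omega>'. \<phi> (case_sum (\<lambda>i. X i \<omega>) (\<lambda>j. Y j \<omega>')))))"

text \<open>
  \<open>Y (Suc i)\<close> is independent from \<open>(Y 1, \<dots>, Y i)\<close>, the latter being read as the tuple of the
  real components \<open>Y k \<omega> $ j\<close> with \<open>1 \<le> k \<le> i\<close> and \<open>j\<close> a coordinate.
\<close>

definition independent_of_past ::
  "(('w \<Rightarrow> real) \<Rightarrow> real) \<Rightarrow> (nat \<Rightarrow> 'w \<Rightarrow> real ^ 'd) \<Rightarrow> nat \<Rightarrow> bool"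
where
  "independent_of_past E Y i \<longleftrightarrow>
     independent_from E
       (UNIV :: 'd set) (\<lambda>j \<omega>. Y (Suc i) \<omega> $ j)
       ({1..i} \<times> (UNIV :: 'd set)) (\<lambda>(k, j) \<omega>. Y k \<omega> $ j)"

text \<open>The last two conjuncts say that \<open>E[\<phi>(\<eta>)]\<close> is the maximum of \<open>\<phi>\<close> over \<open>\<Gamma>\<close>; in particular
  \<open>\<Gamma>\<close> is nonempty.\<close>

definition maximal_distributed ::
  "('w \<Rightarrow> real) set \<Rightarrow> (('w \<Rightarrow> real) \<Rightarrow> real) \<Rightarrow> ('w \<Rightarrow> real ^ 'd) \<Rightarrow> bool"
where
  "maximal_distributed H E \<eta> \<longleftrightarrow> random_vector H \<eta> \<and>
     (\<exists>\<Gamma>. bounded \<Gamma> \<and> closed \<Gamma> \<and> convex \<Gamma> \<and>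
       (\<forall>\<phi>\<in>C_lLip. E (\<lambda>\<omega>. \<phi> (\<eta> \<omega>)) \<in> \<phi> ` \<Gamma> \<and>
                   (\<forall>y\<in>\<Gamma>. \<phi> y \<le> E (\<lambda>\<omega>. \<phi> (\<eta> \<omega>)))))"

definition sublinear_function ::
  "(('w \<Rightarrow> real) \<Rightarrow> real) \<Rightarrow> ('w \<Rightarrow> real ^ 'd) \<Rightarrow> real ^ 'd \<Rightarrow> real"
where
  "sublinear_function E X p = E (\<lambda>\<omega>. p \<bullet> X \<omega>)"

text \<open>
  For \<open>\<phi>\<close> continuous of linear growth, \<open>\<phi>(X)\<close> need not lie in \<open>H\<close>, so \<open>E\<close> is not applied to it
  directly: \<open>extended_expectation E X \<phi>\<close> is its value under the continuous extension of \<open>E\<close> to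
  the completion of \<open>H\<close>, computed along approximations of \<open>\<phi>\<close> from the class \<open>C_lLip\<close>. It
  coincides with \<open>E[\<phi>(X)]\<close> if \<open>\<phi>\<close> itself belongs to \<open>C_lLip\<close>.
\<close>

definition lLip_approximation ::
  "(('w \<Rightarrow> real) \<Rightarrow> real) \<Rightarrow> ('w \<Rightarrow> real ^ 'd) \<Rightarrow> (real ^ 'd \<Rightarrow> real) \<Rightarrow>
   (nat \<Rightarrow> real ^ 'd \<Rightarrow> real) \<Rightarrow> bool"
where
  "lLip_approximation E X \<phi> \<Phi> \<longleftrightarrow> (\<forall>k. \<Phi> k \<in> C_lLip) \<and>
     (\<exists>\<Psi>. (\<forall>k. \<Psi> k \<in> C_lLip) \<and> (\<forall>k x. \<bar>\<phi> x - \<Phi> k x\<bar> \<le> \<Psi> k x) \<and>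
          (\<lambda>k. E (\<lambda>\<omega>. \<Psi> k (X \<omega>))) \<longlonglongrightarrow> 0)"

definition extended_expectation ::
  "(('w \<Rightarrow> real) \<Rightarrow> real) \<Rightarrow> ('w \<Rightarrow> real ^ 'd) \<Rightarrow> (real ^ 'd \<Rightarrow> real) \<Rightarrow> real"
where
  "extended_expectation E X \<phi> =
     (THE v. (\<exists>\<Phi>. lLip_approximation E X \<phi> \<Phi>) \<and>
             (\<forall>\<Phi>. lLip_approximation E X \<phi> \<Phi> \<longrightarrow> (\<lambda>k. E (\<lambda>\<omega>. \<Phi> k (X \<omega>))) \<longlonglongrightarrow> v))"

end

theory Submission
  imports Defs
begin

text \<open>
  Let \<open>G\<close> be the compact convex set with support function \<open>g(p) = E[p \<bullet> Y\<^sub>1]\<close>, and let \<open>S\<^sub>k\<close> be the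
  partial sums. Instead of solving the equation \<open>\<partial>\<^sub>t u = g(D u)\<close>, we test with squared distances, which
  are exact quadratics up to a bounded error in one step. Conditioning on the past, the cross term
  \<open>2 E[p \<bullet> (Y\<^sub>k\<^sub>+\<^sub>1 - b)] = 2 (g(p) - p \<bullet> b)\<close> vanishes for a suitable \<open>b \<in> G\<close>, so that
  \<open>E[dist(S\<^sub>n / n, G)\<^sup>2] = O(1/n)\<close>; and for every fixed \<open>q \<in> G\<close> it is nonnegative, so that
  \<open>E[- |S\<^sub>n / n - q|\<^sup>2] \<ge> - O(1/n)\<close>. A continuous \<open>\<phi>\<close> of linear growth with maximum \<open>\<phi>(q)\<close> over \<open>G\<close>
  satisfies \<open>\<phi>(q) - \<epsilon> - L |x - q|\<^sup>2 \<le> \<phi>(x) \<le> \<phi>(q) + \<epsilon> + K dist(x, G)\<^sup>2\<close>, which gives both bounds.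
\<close>

subsection \<open>Locally Lipschitz functions of polynomial growth\<close>

text \<open>The base \<open>1 + a + b\<close> is at least each of \<open>1\<close>,
  \<open>a\<close>, \<open>b\<close> and at most three times the largest of them. Taking powers
  gives both comparisons.\<close>

lemma weight_le:
  fixes a b :: real
  assumes "0 \<le> a" "0 \<le> b"
  shows "1 + a ^ m + b ^ m \<le> 3 * (1 + a + b) ^ m" and "(1 + a + b) ^ m \<le> 3 ^ m * (1 + a ^ m + b ^ m)"
proof -
  have "1 \<le> (1 + a + b) ^ m" "a ^ m \<le> (1 + a + b) ^ m" "b ^ m \<le> (1 + a + b) ^ m"
    using assms by (auto intro!: power_mono one_le_power)
  then show "1 + a ^ m + b ^ m \<le> 3 * (1 + a + b) ^ m" by simp
next
  define c where "c = max 1 (max a b)"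
  have "(1 + a + b) ^ m \<le> (3 * c) ^ m"
    using assms by (intro power_mono) (auto simp: c_def)
  moreover have "c ^ m \<le> 1 + a ^ m + b ^ m"
    using assms by (auto simp: c_def max_def add_increasing add_increasing2)
  ultimately show "(1 + a + b) ^ m \<le> 3 ^ m * (1 + a ^ m + b ^ m)"
    by (simp add: power_mult_distrib) (smt (verit) mult_left_mono zero_le_power)
qed

text \<open>\<open>N\<close> and \<open>D\<close> stand for a size and a distance, so that one
  argument serves both the Euclidean norm in \<open>C_lLip\<close> and the \<open>L2_set\<close>
  version in \<open>C_lLip_on\<close>.\<close>

lemma ex_weight_iff:
  fixes N :: "'b \<Rightarrow> real" and D V :: "'b \<Rightarrow> 'b \<Rightarrow> real"
  assumes "\<And>x. 0 \<le> N x" "\<And>x y. 0 \<le> D x y"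
  shows "(\<exists>C>0. \<exists>m::nat. \<forall>x y. V x y \<le> C * (1 + N x ^ m + N y ^ m) * D x y) \<longleftrightarrow>
         (\<exists>C m. \<forall>x y. V x y \<le> C * (1 + N x + N y) ^ m * D x y)" (is "?L \<longleftrightarrow> ?R")
proof
  assume ?L
  then obtain C m where C: "C > 0" "\<And>x y. V x y \<le> C * (1 + N x ^ m + N y ^ m) * D x y"
    by blast
  have "V x y \<le> (3 * C) * (1 + N x + N y) ^ m * D x y" for x y
  proof -
    have "C * (1 + N x ^ m + N y ^ m) * D x y \<le> C * (3 * (1 + N x + N y) ^ m) * D x y"
      using C(1) assms weight_le(1)[OF assms(1) assms(1)]
      by (intro mult_right_mono mult_left_mono) auto
    with C(2)[of x y] show ?thesis by (simp add: algebra_simps)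
  qed
  then show ?R by blast
next
  assume ?R
  then obtain C m where C: "\<And>x y. V x y \<le> C * (1 + N x + N y) ^ m * D x y" by blast
  \<comment> \<open>The right-hand form puts no sign on \<open>C\<close>, whereas the left-hand form
    asks for a positive constant; hence \<open>\<bar>C\<bar> + 1\<close>.\<close>
  have "V x y \<le> ((\<bar>C\<bar> + 1) * 3 ^ m) * (1 + N x ^ m + N y ^ m) * D x y" for x y
  proof -
    have "C * (1 + N x + N y) ^ m * D x y \<le> (\<bar>C\<bar> + 1) * (3 ^ m * (1 + N x ^ m + N y ^ m)) * D x y"
      using assms weight_le(2)[OF assms(1) assms(1)]
      by (intro mult_right_mono mult_mono) auto
    with C[of x y] show ?thesis by (simp add: algebra_simps)
  qed
  then show ?L by (intro exI[of _ "(\<bar>C\<bar> + 1) * 3 ^ m"]) (auto intro!: exI[of _ m])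
qed

text \<open>The single weight \<open>(1 + |x| + |y|)\<^sup>m\<close> is monotone in \<open>m\<close> and submultiplicative.\<close>

lemma C_lLip_iff:
  "f \<in> C_lLip \<longleftrightarrow> (\<exists>C m. \<forall>x y. \<bar>f x - f y\<bar> \<le> C * (1 + norm x + norm y) ^ m * norm (x - y))"
  unfolding C_lLip_def mem_Collect_eq by (rule ex_weight_iff) auto

lemma C_lLip_on_iff:
  "f \<in> C_lLip_on I \<longleftrightarrow>
    (\<exists>C m. \<forall>x y. \<bar>f x - f y\<bar> \<le> C * (1 + L2_set x I + L2_set y I) ^ m * L2_set (\<lambda>i. x i - y i) I)"
  unfolding C_lLip_on_def mem_Collect_eq by (rule ex_weight_iff) auto

lemma C_lLipI:
  assumes "\<And>x y. \<bar>f x - f y\<bar> \<le> C * (1 + norm x + norm y) ^ m * norm (x - y)"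
  shows "f \<in> C_lLip"
  using assms unfolding C_lLip_iff by blast

text \<open>One pair of constants controls differences and values for all large exponents, so two
  functions can be given a common exponent. The free second point \<open>y\<close> in the bound on
  \<open>\<bar>f x\<bar>\<close> lets value and difference bounds share one weight in
  products.\<close>

lemma C_lLip_bound:
  fixes f :: "'a::euclidean_space \<Rightarrow> real"
  assumes "f \<in> C_lLip"
  obtains C m where "0 \<le> C"
    and "\<And>n x y. m \<le> n \<Longrightarrow> \<bar>f x - f y\<bar> \<le> C * (1 + norm x + norm y) ^ n * norm (x - y)"
    and "\<And>n x (y::'a). m \<le> n \<Longrightarrow> \<bar>f x\<bar> \<le> C * (1 + norm x + norm y) ^ n"
proof -
  obtain C m where C: "\<And>x y. \<bar>f x - f y\<bar> \<le> C * (1 + norm x + norm y) ^ m * norm (x - y)"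
    using assms unfolding C_lLip_iff by blast
  define B where "B = \<bar>C\<bar> + \<bar>f 0\<bar>"
  have 1: "\<bar>f x - f y\<bar> \<le> \<bar>C\<bar> * (1 + norm x + norm y) ^ n * norm (x - y)" if "m \<le> n" for n x y
  proof -
    have "C * (1 + norm x + norm y) ^ m * norm (x - y) \<le> \<bar>C\<bar> * (1 + norm x + norm y) ^ n * norm (x - y)"
      using that by (intro mult_right_mono mult_mono power_increasing) auto
    with C[of x y] show ?thesis by linarith
  qed
  show thesis
  \<comment> \<open>Bounding a value through \<open>f 0\<close> costs a factor
    \<open>norm x\<close>, which one more power of the weight absorbs.\<close>
  proof (rule that[of B "Suc m"])
    show "0 \<le> B" by (simp add: B_def)
    show "\<bar>f x - f y\<bar> \<le> B * (1 + norm x + norm y) ^ n * norm (x - y)" if "Suc m \<le> n" for n x y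
    proof -
      have "\<bar>C\<bar> * (1 + norm x + norm y) ^ n * norm (x - y) \<le> B * (1 + norm x + norm y) ^ n * norm (x - y)"
        by (intro mult_right_mono) (auto simp: B_def)
      with 1[of n x y] that show ?thesis by linarith
    qed
    show "\<bar>f x\<bar> \<le> B * (1 + norm x + norm y) ^ n" if "Suc m \<le> n" for n x and y :: 'a
    proof -
      let ?w = "1 + norm x + norm y"
      have w: "1 \<le> ?w" by simp
      have "\<bar>f x - f 0\<bar> \<le> \<bar>C\<bar> * (1 + norm x) ^ m * norm x" using 1[of m x 0] by simp
      also have "\<dots> \<le> \<bar>C\<bar> * ?w ^ m * ?w"
        by (intro mult_mono power_mono) auto
      also have "\<dots> = \<bar>C\<bar> * ?w ^ Suc m" by simp
      also have "\<dots> \<le> \<bar>C\<bar> * ?w ^ n"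
        using that w by (intro mult_left_mono power_increasing) auto
      finally have "\<bar>f x - f 0\<bar> \<le> \<bar>C\<bar> * ?w ^ n" .
      moreover have "\<bar>f 0\<bar> * 1 \<le> \<bar>f 0\<bar> * ?w ^ n"
        using w by (intro mult_left_mono one_le_power) auto
      ultimately show ?thesis unfolding B_def by (simp add: algebra_simps)
    qed
  qed
qed

section \<open>Closure properties of the class \<open>C_lLip\<close>\<close>

lemma C_lLip_lipschitz:
  assumes "\<And>x y. \<bar>f x - f y\<bar> \<le> L * norm (x - y)"
  shows "f \<in> C_lLip"
  using assms by (intro C_lLipI[of _ L 0]) simp

lemma C_lLip_const: "(\<lambda>x. c) \<in> C_lLip"
  by (rule C_lLip_lipschitz[of _ 0]) simp

lemma C_lLip_norm: "norm \<in> C_lLip"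
  by (rule C_lLip_lipschitz[of _ 1]) (simp add: norm_triangle_ineq3)

lemma C_lLip_infdist: "(\<lambda>x. infdist x A) \<in> C_lLip"
  by (rule C_lLip_lipschitz[of _ 1]) (simp add: infdist_triangle_abs flip: dist_norm)

lemma C_lLip_linear:
  fixes f :: "'a::euclidean_space \<Rightarrow> real"
  assumes "bounded_linear f"
  shows "f \<in> C_lLip"
proof -
  obtain K where K: "\<And>x. norm (f x) \<le> norm x * K" using bounded_linear.bounded[OF assms] by blast
  show ?thesis
    using K by (intro C_lLip_lipschitz[of _ K])
      (metis bounded_linear.linear[OF assms] linear_diff mult.commute real_norm_def)
qed

lemma C_lLip_add:
  fixes f g :: "'a::euclidean_space \<Rightarrow> real"
  assumes "f \<in> C_lLip" "g \<in> C_lLip"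
  shows "(\<lambda>x. f x + g x) \<in> C_lLip"
proof -
  obtain C m where f: "\<And>n x y. m \<le> n \<Longrightarrow> \<bar>f x - f y\<bar> \<le> C * (1 + norm x + norm y) ^ n * norm (x - y)"
    using C_lLip_bound[OF assms(1)] by metis
  obtain D k where g: "\<And>n x y. k \<le> n \<Longrightarrow> \<bar>g x - g y\<bar> \<le> D * (1 + norm x + norm y) ^ n * norm (x - y)"
    using C_lLip_bound[OF assms(2)] by metis
  have "\<bar>(f x + g x) - (f y + g y)\<bar> \<le> (C + D) * (1 + norm x + norm y) ^ (m + k) * norm (x - y)" for x y
    using f[of "m + k" x y] g[of "m + k" x y] by (simp add: algebra_simps)
  then show ?thesis by (rule C_lLipI)
qed

lemma C_lLip_mult:
  fixes f g :: "'a::euclidean_space \<Rightarrow> real"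
  assumes "f \<in> C_lLip" "g \<in> C_lLip"
  shows "(\<lambda>x. f x * g x) \<in> C_lLip"
proof -
  obtain C m where C: "0 \<le> C"
    and f: "\<And>n x y. m \<le> n \<Longrightarrow> \<bar>f x - f y\<bar> \<le> C * (1 + norm x + norm y) ^ n * norm (x - y)"
    and f': "\<And>n x (y::'a). m \<le> n \<Longrightarrow> \<bar>f x\<bar> \<le> C * (1 + norm x + norm y) ^ n"
    using C_lLip_bound[OF assms(1)] by metis
  obtain D k where D: "0 \<le> D"
    and g: "\<And>n x y. k \<le> n \<Longrightarrow> \<bar>g x - g y\<bar> \<le> D * (1 + norm x + norm y) ^ n * norm (x - y)"
    and g': "\<And>n x (y::'a). k \<le> n \<Longrightarrow> \<bar>g x\<bar> \<le> D * (1 + norm x + norm y) ^ n"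
    using C_lLip_bound[OF assms(2)] by metis
  have "\<bar>f x * g x - f y * g y\<bar> \<le> (2 * C * D) * (1 + norm x + norm y) ^ (m + k) * norm (x - y)" for x y
  proof -
    let ?w = "1 + norm x + norm y"
    have "\<bar>f x * g x - f y * g y\<bar> = \<bar>f x * (g x - g y) + g y * (f x - f y)\<bar>"
      by (simp add: algebra_simps)
    also have "\<dots> \<le> \<bar>f x\<bar> * \<bar>g x - g y\<bar> + \<bar>g y\<bar> * \<bar>f x - f y\<bar>"
      by (metis abs_mult abs_triangle_ineq)
    also have "\<dots> \<le> (C * ?w ^ m) * (D * ?w ^ k * norm (x - y)) + (D * ?w ^ k) * (C * ?w ^ m * norm (x - y))"
      using f[of m x y] f'[of m x y] g[of k x y] g'[of k y x] C D
      by (intro add_mono mult_mono) (auto simp: add_ac)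
    also have "\<dots> = (2 * C * D) * ?w ^ (m + k) * norm (x - y)"
      by (simp add: power_add algebra_simps)
    finally show ?thesis .
  qed
  then show ?thesis by (rule C_lLipI)
qed

lemma C_lLip_uminus: "f \<in> C_lLip \<Longrightarrow> (\<lambda>x. - f x) \<in> C_lLip"
  using C_lLip_mult[OF C_lLip_const[of "- 1"]] by simp

lemma C_lLip_power: "f \<in> C_lLip \<Longrightarrow> (\<lambda>x. f x ^ n) \<in> C_lLip"
  by (induction n) (simp_all add: C_lLip_const C_lLip_mult)

lemma lipschitz_weight_le:
  fixes A :: "'x \<Rightarrow> 'b::real_normed_vector"
  assumes "0 \<le> K" "\<And>x. norm (A x) \<le> norm c + K * N x" "\<And>x. 0 \<le> N x"
  shows "1 + norm (A x) + norm (A y) \<le> (1 + 2 * norm c + K) * (1 + N x + N y)"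
proof -
  have "1 + norm (A x) + norm (A y) \<le> 1 + (norm c + K * N x) + (norm c + K * N y)"
    using assms(2)[of x] assms(2)[of y] by linarith
  also have "\<dots> \<le> (1 + 2 * norm c + K) * (1 + N x + N y)"
    using assms by (simp add: algebra_simps)
  finally show ?thesis .
qed

text \<open>An inner map of at most affine growth changes the weight only by a constant factor. Size
  and distance are abstract because the source is a Euclidean space in one application and a space
  of tuples in the other.\<close>

lemma C_lLip_compose_bound:
  fixes A :: "'x \<Rightarrow> 'b::euclidean_space"
  assumes f: "f \<in> C_lLip" and K: "0 \<le> K"
    and A: "\<And>x. norm (A x) \<le> norm c + K * N x" "\<And>x y. norm (A x - A y) \<le> K * D x y"
    and pos: "\<And>x. 0 \<le> N x" "\<And>x y. 0 \<le> D x y"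
  shows "\<exists>C m. \<forall>x y. \<bar>f (A x) - f (A y)\<bar> \<le> C * (1 + N x + N y) ^ m * D x y"
proof -
  obtain C m where C: "0 \<le> C"
    and f: "\<And>n x y. m \<le> n \<Longrightarrow> \<bar>f x - f y\<bar> \<le> C * (1 + norm x + norm y) ^ n * norm (x - y)"
    using C_lLip_bound[OF f] by metis
  have "\<bar>f (A x) - f (A y)\<bar> \<le> (C * (1 + 2 * norm c + K) ^ m * K) * (1 + N x + N y) ^ m * D x y" for x y
  proof -
    have "\<bar>f (A x) - f (A y)\<bar> \<le> C * (1 + norm (A x) + norm (A y)) ^ m * norm (A x - A y)"
      using f by blast
    also have "\<dots> \<le> C * ((1 + 2 * norm c + K) * (1 + N x + N y)) ^ m * (K * D x y)"
      using C A K pos by (intro mult_mono mult_left_mono power_mono lipschitz_weight_le) auto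
    finally show ?thesis by (simp only: power_mult_distrib mult.assoc mult.left_commute)
  qed
  then show ?thesis by blast
qed

lemma C_lLip_compose:
  assumes "f \<in> C_lLip" and A: "\<And>x y. norm (A x - A y) \<le> K * norm (x - y)"
  shows "(\<lambda>x. f (A x)) \<in> C_lLip"
  unfolding C_lLip_iff
proof (rule C_lLip_compose_bound[OF assms(1), of "\<bar>K\<bar>" _ "A 0"])
  show *: "norm (A x - A y) \<le> \<bar>K\<bar> * norm (x - y)" for x y
    using A[of x y] by (smt (verit) mult_right_mono norm_ge_zero)
  show "norm (A x) \<le> norm (A 0) + \<bar>K\<bar> * norm x" for x
    using *[of x 0] norm_triangle_ineq2[of "A x" "A 0"] by simp
qed auto

lemma C_lLip_shift: "f \<in> C_lLip \<Longrightarrow> (\<lambda>x. f (s + x)) \<in> C_lLip"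
  by (rule C_lLip_compose[of _ _ 1]) auto

lemma C_lLip_norm_diff: "(\<lambda>x. norm (x - c)) \<in> C_lLip"
  using C_lLip_shift[OF C_lLip_norm, of "- c"] by simp

lemma C_lLip_scaleR: "f \<in> C_lLip \<Longrightarrow> (\<lambda>x. f (c *\<^sub>R x)) \<in> C_lLip"
  by (rule C_lLip_compose[of _ _ "\<bar>c\<bar>"]) (auto simp flip: scaleR_diff_right)

text \<open>Since \<open>A\<close> respects differences, its size bound is at the same time a
  Lipschitz bound, and the offset in the affine growth bound can be taken to be
  \<open>0\<close>.\<close>

lemma C_lLip_on_compose:
  fixes A :: "('i \<Rightarrow> real) \<Rightarrow> 'a::euclidean_space"
  assumes f: "f \<in> C_lLip" and K: "0 \<le> K" and bound: "\<And>x. norm (A x) \<le> K * L2_set x I"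
    and diff: "\<And>x y. A x - A y = A (\<lambda>i. x i - y i)"
  shows "(\<lambda>x. f (A x)) \<in> C_lLip_on I"
  unfolding C_lLip_on_iff
  using bound by (intro C_lLip_compose_bound[OF f K, of _ 0]) (auto simp: diff)

section \<open>Approximation and quadratic bounds for continuous functions of linear growth\<close>

lemma continuous_on_C_lLip:
  assumes "f \<in> C_lLip"
  shows "continuous_on S f"
proof -
  obtain C m where f: "\<And>x y. \<bar>f x - f y\<bar> \<le> C * (1 + norm x + norm y) ^ m * norm (x - y)"
    using assms unfolding C_lLip_iff by blast
  have "isCont f y" for y
  proof -
    have "((\<lambda>x. C * (1 + norm x + norm y) ^ m * norm (x - y)) \<longlongrightarrow>
        C * (1 + norm y + norm y) ^ m * norm (y - y)) (at y)"
      by (intro tendsto_intros)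
    then have "((\<lambda>x. C * (1 + norm x + norm y) ^ m * norm (x - y)) \<longlongrightarrow> 0) (at y)" by simp
    then have "((\<lambda>x. f x - f y) \<longlongrightarrow> 0) (at y)"
      by (rule Lim_null_comparison[rotated]) (use f in auto)
    then show ?thesis unfolding isCont_def using Lim_null by blast
  qed
  then show ?thesis by (simp add: continuous_at_imp_continuous_on)
qed

lemma real_polynomial_function_C_lLip: "real_polynomial_function p \<Longrightarrow> p \<in> C_lLip"
  by (induction rule: real_polynomial_function.induct)
    (simp_all add: C_lLip_linear C_lLip_const C_lLip_add C_lLip_mult)

text \<open>On a large ball a polynomial approximates \<open>\<phi>\<close> by Stone-Weierstrass.
  Composed with the nearest-point projection onto the ball, which is 1-Lipschitz, it stays in
  \<open>C_lLip\<close> and remains bounded outside, where the linear growth of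
  \<open>\<phi>\<close> is small against \<open>e * norm x ^ 2\<close>.\<close>

lemma ex_C_lLip_approximation:
  fixes \<phi> :: "'a::euclidean_space \<Rightarrow> real"
  assumes cont: "continuous_on UNIV \<phi>" and growth: "\<And>x. \<bar>\<phi> x\<bar> \<le> C * (1 + norm x)" and "0 < e"
  shows "\<exists>\<Phi>\<in>C_lLip. \<forall>x. \<bar>\<phi> x - \<Phi> x\<bar> \<le> e * (1 + norm x ^ 2)"
proof -
  \<comment> \<open>Outside the ball, \<open>1 \<le> R\<close> bounds the values of
    \<open>\<phi>\<close> at \<open>x\<close> and at its projection together by
    \<open>4 * C * norm x\<close>, and \<open>4 * C \<le> e * R\<close> turns this into
    \<open>e * norm x ^ 2\<close>.\<close>
  define R where "R = max 1 (4 * C / e)"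
  have R: "1 \<le> R" "4 * C \<le> e * R" using \<open>0 < e\<close> by (auto simp: R_def max_def field_simps)
  have C0: "0 \<le> C" using growth[of 0] by simp
  let ?B = "cball 0 R :: 'a set"
  define \<pi> where "\<pi> = closest_point ?B"
  obtain p where p: "real_polynomial_function p" "\<And>x. x \<in> ?B \<Longrightarrow> \<bar>\<phi> x - p x\<bar> < e"
    using Stone_Weierstrass_real_polynomial_function[OF compact_cball
        continuous_on_subset[OF cont subset_UNIV] \<open>0 < e\<close>] by blast
  have ne: "?B \<noteq> {}" using R by auto
  have \<pi>: "\<pi> x \<in> ?B" for x unfolding \<pi>_def by (rule closest_point_in_set) (use ne in auto)
  have lip: "norm (\<pi> x - \<pi> y) \<le> 1 * norm (x - y)" for x y
    unfolding \<pi>_def using closest_point_lipschitz[of ?B x y] ne by (simp add: dist_norm)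
  have "\<bar>\<phi> x - p (\<pi> x)\<bar> \<le> e * (1 + norm x ^ 2)" for x
  proof (cases "x \<in> ?B")
    case True
    then have "\<pi> x = x" unfolding \<pi>_def by (rule closest_point_self)
    then show ?thesis using p(2)[OF True] \<open>0 < e\<close> by (simp add: distrib_left) (smt (verit) mult_nonneg_nonneg zero_le_power2)
  next
    case False
    then have x: "R < norm x" by simp
    have "\<bar>\<phi> x - p (\<pi> x)\<bar> \<le> \<bar>\<phi> x\<bar> + \<bar>\<phi> (\<pi> x)\<bar> + e" using p(2)[OF \<pi>[of x]] by linarith
    also have "\<dots> \<le> C * (1 + norm x) + C * (1 + norm (\<pi> x)) + e" using growth[of x] growth[of "\<pi> x"] by linarith
    also have "\<dots> \<le> C * (2 * norm x) + C * (2 * norm x) + e"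
      using \<pi>[of x] x R C0 by (intro add_mono mult_left_mono) auto
    also have "\<dots> = 4 * C * norm x + e" by simp
    also have "\<dots> \<le> (e * norm x) * norm x + e"
    proof -
      have "e * R \<le> e * norm x" using x \<open>0 < e\<close> by simp
      then show ?thesis using R by (intro add_right_mono mult_right_mono) auto
    qed
    finally show ?thesis by (simp add: algebra_simps power2_eq_square)
  qed
  moreover have "(\<lambda>x. p (\<pi> x)) \<in> C_lLip"
    using real_polynomial_function_C_lLip[OF p(1)] lip by (rule C_lLip_compose)
  ultimately show ?thesis by (intro bexI[of _ "\<lambda>x. p (\<pi> x)"] allI)
qed

text \<open>By compactness \<open>\<phi> < M + e\<close> on a whole neighbourhood of
  \<open>G\<close> of some radius \<open>d\<close>; beyond it, a multiple of the squared distance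
  dominates the linear growth.\<close>

lemma le_infdist_square:
  fixes \<phi> :: "'a::euclidean_space \<Rightarrow> real"
  assumes cont: "continuous_on UNIV \<phi>" and growth: "\<And>x. \<bar>\<phi> x\<bar> \<le> C * (1 + norm x)"
    and G: "compact G" "G \<noteq> {}" and M: "\<And>x. x \<in> G \<Longrightarrow> \<phi> x \<le> M" and "0 < e"
  shows "\<exists>K\<ge>0. \<forall>x. \<phi> x \<le> M + e + K * infdist x G ^ 2"
proof -
  have "open {x. \<phi> x < M + e}"
    using cont by (intro open_Collect_less) auto
  moreover have "G \<subseteq> {x. \<phi> x < M + e}" using M \<open>0 < e\<close> by force
  ultimately obtain d where d: "0 < d" "{x. infdist x G \<le> d} \<subseteq> {x. \<phi> x < M + e}"
    using compact_in_open_separated[OF G(2,1)] by metis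
  obtain R where R: "\<And>x. x \<in> G \<Longrightarrow> norm x \<le> R"
    using compact_imp_bounded[OF G(1)] bounded_iff by metis
  have R0: "0 \<le> R" using R G(2) by (meson all_not_in_conv norm_ge_zero order_trans)
  have C0: "0 \<le> C" using growth[of 0] by simp
  \<comment> \<open>For a distance \<open>t > d\<close> one has \<open>1 \<le> t^2 / d^2\<close> and
    \<open>t \<le> t^2 / d\<close>, which turns \<open>C * (1 + R + t)\<close> into a multiple of
    \<open>t^2\<close>. The extra \<open>\<bar>M\<bar>\<close> covers a negative
    \<open>M\<close>.\<close>
  define K where "K = (C * (1 + R) + \<bar>M\<bar>) / d ^ 2 + C / d"
  have "0 \<le> K" using C0 R0 d by (auto simp: K_def)
  moreover have "\<phi> x \<le> M + e + K * infdist x G ^ 2" for x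
  proof (cases "infdist x G \<le> d")
    case True
    then have "\<phi> x < M + e" using d by auto
    then show ?thesis using \<open>0 \<le> K\<close> by (smt (verit) mult_nonneg_nonneg zero_le_power2)
  next
    case False
    let ?t = "infdist x G"
    have t: "d < ?t" using False by simp
    obtain a where a: "a \<in> G" "?t = dist x a"
      using infdist_attains_inf[OF compact_imp_closed[OF G(1)] G(2)] by metis
    have "norm x \<le> R + ?t"
      using R[OF a(1)] a(2) norm_triangle_ineq[of a "x - a"] by (simp add: dist_norm)
    then have "\<phi> x \<le> C * (1 + (R + ?t))"
      using growth[of x] C0 by (smt (verit) mult_left_mono)
    also have "\<dots> = (C * (1 + R) + \<bar>M\<bar>) * 1 + C * ?t - \<bar>M\<bar>" by (simp add: algebra_simps)
    also have "\<dots> \<le> (C * (1 + R) + \<bar>M\<bar>) * (?t ^ 2 / d ^ 2) + C * (?t ^ 2 / d) - \<bar>M\<bar>"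
      using t d C0 R0
      by (intro diff_right_mono add_mono mult_left_mono)
        (auto simp: field_simps power2_eq_square intro!: mult_mono)
    also have "\<dots> = K * ?t ^ 2 - \<bar>M\<bar>" by (simp add: K_def algebra_simps)
    finally show ?thesis using \<open>0 < e\<close> by linarith
  qed
  ultimately show ?thesis by blast
qed

text \<open>This is the preceding bound for \<open>- \<phi>\<close> and the compact set
  \<open>{q}\<close>. The minus sign stays on the square because \<open>E\<close> releases only
  nonnegative factors such as \<open>L\<close>.\<close>

corollary ge_dist_square:
  fixes \<phi> :: "'a::euclidean_space \<Rightarrow> real"
  assumes cont: "continuous_on UNIV \<phi>" and growth: "\<And>x. \<bar>\<phi> x\<bar> \<le> C * (1 + norm x)" and "0 < e"
  shows "\<exists>L\<ge>0. \<forall>x. L * - (norm (x - q))\<^sup>2 + (\<phi> q - e) \<le> \<phi> x"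
proof -
  have "\<exists>L\<ge>0. \<forall>x. - \<phi> x \<le> - \<phi> q + e + L * (infdist x {q})\<^sup>2"
    using cont growth \<open>0 < e\<close> by (intro le_infdist_square[of _ C]) (auto intro: continuous_on_minus)
  then obtain L where L: "0 \<le> L" "\<And>x. - \<phi> x \<le> - \<phi> q + e + L * (infdist x {q})\<^sup>2" by blast
  have "L * - (norm (x - q))\<^sup>2 + (\<phi> q - e) \<le> \<phi> x" for x
    using L(2)[of x] by (simp add: dist_norm)
  with L(1) show ?thesis by blast
qed

subsection \<open>Random vectors and the extended expectation\<close>

context sublinear_expectation_space
begin

lemma H_sum:
  assumes "\<And>i. i \<in> I \<Longrightarrow> X i \<in> H"
  shows "(\<lambda>\<omega>. \<Sum>i\<in>I. X i \<omega>) \<in> H"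
  using assms by (induction I rule: infinite_finite_induct) (auto intro: H_const H_add)

text \<open>The axiom \<open>H_comp\<close> speaks of tuples indexed by \<open>{..<n}\<close>. An
  enumeration \<open>e\<close> of the coordinates carries it over to vectors, the norms agreeing by
  reindexing the sum of squares.\<close>

lemma H_comp_random_vector:
  fixes X :: "'w \<Rightarrow> real ^ 'd"
  assumes X: "random_vector H X" and \<phi>: "\<phi> \<in> C_lLip"
  shows "(\<lambda>\<omega>. \<phi> (X \<omega>)) \<in> H"
proof -
  let ?n = "CARD('d)"
  obtain e where e: "bij_betw e {..<?n} (UNIV :: 'd set)"
    using ex_bij_betw_nat_finite[of "UNIV :: 'd set"] by (auto simp: atLeast0LessThan)
  define e' where "e' = inv_into {..<?n} e"
  have e': "bij_betw e' UNIV {..<?n}" unfolding e'_def using e by (rule bij_betw_inv_into)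
  have ee': "e (e' j) = j" for j unfolding e'_def using e by (simp add: bij_betw_inv_into_right)
  have "norm (\<chi> j. z (e' j)) = L2_set z {..<?n}" for z :: "nat \<Rightarrow> real"
    using sum.reindex_bij_betw[OF e', of "\<lambda>i. (z i)\<^sup>2"]
    by (simp add: norm_vec_def L2_set_def)
  then have "(\<lambda>z. \<phi> (\<chi> j. z (e' j))) \<in> C_lLip_on {..<?n}"
    by (intro C_lLip_on_compose[OF \<phi>, of 1]) (auto simp: vec_eq_iff)
  from H_comp[OF this, of "\<lambda>i \<omega>. X \<omega> $ e i"] show ?thesis
    using X by (simp add: random_vector_def ee')
qed

lemma random_vector_sum:
  assumes "\<And>i. i \<in> I \<Longrightarrow> random_vector H (X i)"
  shows "random_vector H (\<lambda>\<omega>. \<Sum>i\<in>I. X i \<omega>)"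
  using assms by (auto simp: random_vector_def intro: H_sum)

lemma random_vector_scaleR: "random_vector H X \<Longrightarrow> random_vector H (\<lambda>\<omega>. c *\<^sub>R X \<omega>)"
  by (auto simp: random_vector_def intro: H_scale)

text \<open>Although \<open>E\<close> is only subadditive, constants pass through exactly: adding
  \<open>- c\<close> back gives the reverse inequality.\<close>

lemma E_add_const:
  assumes "X \<in> H"
  shows "E (\<lambda>\<omega>. X \<omega> + c) = E X + c"
proof (rule antisym)
  show "E (\<lambda>\<omega>. X \<omega> + c) \<le> E X + c"
    using E_subadd[OF assms H_const[of c]] by (simp add: E_const)
  have "(\<lambda>\<omega>. X \<omega> + c) \<in> H" using assms H_const by (rule H_add)
  from E_subadd[OF this H_const[of "- c"]] show "E X + c \<le> E (\<lambda>\<omega>. X \<omega> + c)"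
    by (simp add: E_const)
qed

lemma E_diff_le:
  assumes "X \<in> H" "Z \<in> H" "W \<in> H" "\<And>\<omega>. \<bar>X \<omega> - Z \<omega>\<bar> \<le> W \<omega>"
  shows "\<bar>E X - E Z\<bar> \<le> E W"
proof -
  have *: "E X \<le> E Z + E W" if "X \<in> H" "Z \<in> H" "\<And>\<omega>. \<bar>X \<omega> - Z \<omega>\<bar> \<le> W \<omega>" for X Z
  proof -
    have "E X \<le> E (\<lambda>\<omega>. Z \<omega> + W \<omega>)"
      using that assms(3) by (intro E_mono H_add) (auto simp: abs_le_iff algebra_simps)
    also have "\<dots> \<le> E Z + E W" using that assms(3) by (intro E_subadd)
    finally show ?thesis .
  qed
  show ?thesis using *[OF assms(1,2,4)] *[of Z X] assms by (force simp: abs_le_iff abs_minus_commute)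
qed

section \<open>Well-definedness and monotonicity of the extended expectation\<close>

lemma lLip_approximations_close:
  assumes X: "random_vector H X"
    and C: "\<Phi> \<in> C_lLip" "\<Psi> \<in> C_lLip" "\<Phi>' \<in> C_lLip" "\<Psi>' \<in> C_lLip"
    and bound: "\<And>x. \<bar>\<phi> x - \<Phi> x\<bar> \<le> \<Psi> x" "\<And>x. \<bar>\<phi> x - \<Phi>' x\<bar> \<le> \<Psi>' x"
  shows "\<bar>E (\<lambda>\<omega>. \<Phi> (X \<omega>)) - E (\<lambda>\<omega>. \<Phi>' (X \<omega>))\<bar> \<le> E (\<lambda>\<omega>. \<Psi> (X \<omega>)) + E (\<lambda>\<omega>. \<Psi>' (X \<omega>))"
proof -
  note H = H_comp_random_vector[OF X]
  have "\<bar>E (\<lambda>\<omega>. \<Phi> (X \<omega>)) - E (\<lambda>\<omega>. \<Phi>' (X \<omega>))\<bar> \<le> E (\<lambda>\<omega>. \<Psi> (X \<omega>) + \<Psi>' (X \<omega>))"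
  proof (rule E_diff_le)
    show "\<bar>\<Phi> (X \<omega>) - \<Phi>' (X \<omega>)\<bar> \<le> \<Psi> (X \<omega>) + \<Psi>' (X \<omega>)" for \<omega>
      using bound[of "X \<omega>"] by linarith
  qed (use C in \<open>auto intro: H H_add\<close>)
  also have "\<dots> \<le> E (\<lambda>\<omega>. \<Psi> (X \<omega>)) + E (\<lambda>\<omega>. \<Psi>' (X \<omega>))"
    using C by (intro E_subadd H)
  finally show ?thesis .
qed

text \<open>With tolerances \<open>1 / (k + 1)\<close>, every error bound is a multiple of the
  single function \<open>1 + norm x ^ 2\<close>, so the expected errors are multiples of one real
  number and tend to zero.\<close>

lemma ex_lLip_approximation:
  fixes X :: "'w \<Rightarrow> real ^ 'd"
  assumes X: "random_vector H X" and cont: "continuous_on UNIV \<phi>"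
    and growth: "\<And>x. \<bar>\<phi> x\<bar> \<le> C * (1 + norm x)"
  shows "\<exists>\<Phi>. lLip_approximation E X \<phi> \<Phi>"
proof -
  have "\<exists>\<Phi>\<in>C_lLip. \<forall>x. \<bar>\<phi> x - \<Phi> x\<bar> \<le> inverse (real (Suc k)) * (1 + norm x ^ 2)" for k
    using cont growth by (rule ex_C_lLip_approximation) simp
  then obtain \<Phi> where \<Phi>: "\<And>k. \<Phi> k \<in> C_lLip"
    "\<And>k x. \<bar>\<phi> x - \<Phi> k x\<bar> \<le> inverse (real (Suc k)) * (1 + norm x ^ 2)"
    by metis
  have sq: "(\<lambda>x::real ^ 'd. 1 + norm x ^ 2) \<in> C_lLip"
    by (intro C_lLip_add C_lLip_const C_lLip_power C_lLip_norm)
  have "E (\<lambda>\<omega>. inverse (real (Suc k)) * (1 + norm (X \<omega>) ^ 2))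
      = inverse (real (Suc k)) * E (\<lambda>\<omega>. 1 + norm (X \<omega>) ^ 2)" for k
    using H_comp_random_vector[OF X sq] by (intro E_pos_homogeneous) auto
  moreover have "(\<lambda>k. inverse (real (Suc k)) * E (\<lambda>\<omega>. 1 + norm (X \<omega>) ^ 2)) \<longlonglongrightarrow> 0"
    using tendsto_mult_left_zero[OF LIMSEQ_inverse_real_of_nat] .
  moreover have "(\<lambda>x::real ^ 'd. inverse (real (Suc k)) * (1 + norm x ^ 2)) \<in> C_lLip" for k
    by (intro C_lLip_mult C_lLip_const sq)
  ultimately have "lLip_approximation E X \<phi> \<Phi>"
    unfolding lLip_approximation_def using \<Phi>
    by (intro conjI allI exI[of _ "\<lambda>k x. inverse (real (Suc k)) * (1 + norm x ^ 2)"]) auto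
  then show ?thesis by (rule exI[of _ \<Phi>])
qed

text \<open>This justifies the definite description in \<open>extended_expectation\<close>: the
  expectations along one approximation form a Cauchy sequence, and those along any other differ from
  them by at most the sum of the two expected errors.\<close>

lemma lLip_approximation_tendsto:
  fixes X :: "'w \<Rightarrow> real ^ 'd"
  assumes X: "random_vector H X" and cont: "continuous_on UNIV \<phi>"
    and growth: "\<And>x. \<bar>\<phi> x\<bar> \<le> C * (1 + norm x)"
    and \<Phi>: "lLip_approximation E X \<phi> \<Phi>"
  shows "(\<lambda>k. E (\<lambda>\<omega>. \<Phi> k (X \<omega>))) \<longlonglongrightarrow> extended_expectation E X \<phi>"
proof -
  define a where "a \<Phi> k = E (\<lambda>\<omega>. \<Phi> k (X \<omega>))" for \<Phi> :: "nat \<Rightarrow> real ^ 'd \<Rightarrow> real" and k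
  obtain \<Psi> where \<Psi>: "a \<Psi> \<longlonglongrightarrow> 0" and C: "\<And>k. \<Phi> k \<in> C_lLip" "\<And>k. \<Psi> k \<in> C_lLip"
    and bound: "\<And>k x. \<bar>\<phi> x - \<Phi> k x\<bar> \<le> \<Psi> k x"
    using \<Phi> unfolding lLip_approximation_def a_def by auto
  have "Cauchy (a \<Phi>)"
  proof (rule CauchyI)
    fix e :: real assume "0 < e"
    then have "\<forall>\<^sub>F k in sequentially. a \<Psi> k < e / 2" using \<Psi> by (intro order_tendstoD(2)) auto
    then obtain N where N: "\<And>k. k \<ge> N \<Longrightarrow> a \<Psi> k < e / 2" by (auto simp: eventually_sequentially)
    have "norm (a \<Phi> k - a \<Phi> l) < e" if "k \<ge> N" "l \<ge> N" for k l
      using lLip_approximations_close[OF X C(1)[of k] C(2)[of k] C(1)[of l] C(2)[of l] bound bound]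
        N[OF that(1)] N[OF that(2)] unfolding a_def by simp
    then show "\<exists>M. \<forall>m\<ge>M. \<forall>n\<ge>M. norm (a \<Phi> m - a \<Phi> n) < e" by blast
  qed
  then obtain v where v: "a \<Phi> \<longlonglongrightarrow> v" using Cauchy_convergent convergent_def by blast
  have all: "a \<Phi>' \<longlonglongrightarrow> v" if \<Phi>': "lLip_approximation E X \<phi> \<Phi>'" for \<Phi>'
  proof -
    obtain \<Psi>' where \<Psi>': "a \<Psi>' \<longlonglongrightarrow> 0" and C': "\<And>k. \<Phi>' k \<in> C_lLip" "\<And>k. \<Psi>' k \<in> C_lLip"
      and bound': "\<And>k x. \<bar>\<phi> x - \<Phi>' k x\<bar> \<le> \<Psi>' k x"
      using \<Phi>' unfolding lLip_approximation_def a_def by auto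
    have "(\<lambda>k. a \<Psi>' k + a \<Psi> k) \<longlonglongrightarrow> 0" using tendsto_add[OF \<Psi>' \<Psi>] by simp
    then have "(\<lambda>k. a \<Phi>' k - a \<Phi> k) \<longlonglongrightarrow> 0"
    proof (rule Lim_null_comparison[rotated])
      show "\<forall>\<^sub>F k in sequentially. norm (a \<Phi>' k - a \<Phi> k) \<le> a \<Psi>' k + a \<Psi> k"
        using lLip_approximations_close[OF X C'(1) C'(2) C(1) C(2) bound' bound]
        unfolding a_def by simp
    qed
    from tendsto_add[OF this v] show ?thesis by simp
  qed
  have "extended_expectation E X \<phi> = v"
    unfolding extended_expectation_def
  proof (rule the_equality)
    show "(\<exists>\<Phi>. lLip_approximation E X \<phi> \<Phi>) \<and>
      (\<forall>\<Phi>. lLip_approximation E X \<phi> \<Phi> \<longrightarrow> (\<lambda>k. E (\<lambda>\<omega>. \<Phi> k (X \<omega>))) \<longlonglongrightarrow> v)"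
      using all \<Phi> unfolding a_def by blast
    show "u = v" if "(\<exists>\<Phi>. lLip_approximation E X \<phi> \<Phi>) \<and>
      (\<forall>\<Phi>. lLip_approximation E X \<phi> \<Phi> \<longrightarrow> (\<lambda>k. E (\<lambda>\<omega>. \<Phi> k (X \<omega>))) \<longlonglongrightarrow> u)" for u
      using that \<Phi> v LIMSEQ_unique unfolding a_def by blast
  qed
  with v show ?thesis unfolding a_def by simp
qed

text \<open>As \<open>\<phi> (X \<omega>)\<close> need not define an element of \<open>H\<close>,
  monotonicity of \<open>E\<close> is applied to \<open>\<Phi> k \<le> f + \<Psi> k\<close> instead,
  followed by passage to the limit in \<open>k\<close>.\<close>

lemma extended_expectation_le:
  fixes X :: "'w \<Rightarrow> real ^ 'd"
  assumes X: "random_vector H X" and cont: "continuous_on UNIV \<phi>"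
    and growth: "\<And>x. \<bar>\<phi> x\<bar> \<le> C * (1 + norm x)"
    and f: "f \<in> C_lLip" "\<And>x. \<phi> x \<le> f x"
  shows "extended_expectation E X \<phi> \<le> E (\<lambda>\<omega>. f (X \<omega>))"
proof -
  obtain \<Phi> where \<Phi>: "lLip_approximation E X \<phi> \<Phi>" using ex_lLip_approximation[OF X cont growth] ..
  obtain \<Psi> where \<Psi>: "(\<lambda>k. E (\<lambda>\<omega>. \<Psi> k (X \<omega>))) \<longlonglongrightarrow> 0" and C: "\<And>k. \<Phi> k \<in> C_lLip" "\<And>k. \<Psi> k \<in> C_lLip"
    and bound: "\<And>k x. \<bar>\<phi> x - \<Phi> k x\<bar> \<le> \<Psi> k x"
    using \<Phi> unfolding lLip_approximation_def by auto
  note H = H_comp_random_vector[OF X]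
  have "E (\<lambda>\<omega>. \<Phi> k (X \<omega>)) \<le> E (\<lambda>\<omega>. f (X \<omega>)) + E (\<lambda>\<omega>. \<Psi> k (X \<omega>))" for k
  proof -
    have "\<Phi> k x \<le> f x + \<Psi> k x" for x using bound[where k=k and x=x] f(2)[of x] by linarith
    then have "E (\<lambda>\<omega>. \<Phi> k (X \<omega>)) \<le> E (\<lambda>\<omega>. f (X \<omega>) + \<Psi> k (X \<omega>))"
      using C f by (intro E_mono H H_add)
    also have "\<dots> \<le> E (\<lambda>\<omega>. f (X \<omega>)) + E (\<lambda>\<omega>. \<Psi> k (X \<omega>))"
      using C f by (intro E_subadd H)
    finally show ?thesis .
  qed
  moreover have "(\<lambda>k. E (\<lambda>\<omega>. f (X \<omega>)) + E (\<lambda>\<omega>. \<Psi> k (X \<omega>))) \<longlonglongrightarrow> E (\<lambda>\<omega>. f (X \<omega>)) + 0"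
    by (intro tendsto_intros \<Psi>)
  ultimately show ?thesis
    using LIMSEQ_le[OF lLip_approximation_tendsto[OF X cont growth \<Phi>]] by force
qed

text \<open>Since \<open>E\<close> is not odd, this does not follow from the upper bound by
  negation; the argument is repeated with \<open>f \<le> \<Phi> k + \<Psi> k\<close>.\<close>

lemma extended_expectation_ge:
  fixes X :: "'w \<Rightarrow> real ^ 'd"
  assumes X: "random_vector H X" and cont: "continuous_on UNIV \<phi>"
    and growth: "\<And>x. \<bar>\<phi> x\<bar> \<le> C * (1 + norm x)"
    and f: "f \<in> C_lLip" "\<And>x. f x \<le> \<phi> x"
  shows "E (\<lambda>\<omega>. f (X \<omega>)) \<le> extended_expectation E X \<phi>"
proof -
  obtain \<Phi> where \<Phi>: "lLip_approximation E X \<phi> \<Phi>" using ex_lLip_approximation[OF X cont growth] ..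
  obtain \<Psi> where \<Psi>: "(\<lambda>k. E (\<lambda>\<omega>. \<Psi> k (X \<omega>))) \<longlonglongrightarrow> 0" and C: "\<And>k. \<Phi> k \<in> C_lLip" "\<And>k. \<Psi> k \<in> C_lLip"
    and bound: "\<And>k x. \<bar>\<phi> x - \<Phi> k x\<bar> \<le> \<Psi> k x"
    using \<Phi> unfolding lLip_approximation_def by auto
  note H = H_comp_random_vector[OF X]
  have "E (\<lambda>\<omega>. f (X \<omega>)) \<le> E (\<lambda>\<omega>. \<Phi> k (X \<omega>)) + E (\<lambda>\<omega>. \<Psi> k (X \<omega>))" for k
  proof -
    have "f x \<le> \<Phi> k x + \<Psi> k x" for x using bound[where k=k and x=x] f(2)[of x] by linarith
    then have "E (\<lambda>\<omega>. f (X \<omega>)) \<le> E (\<lambda>\<omega>. \<Phi> k (X \<omega>) + \<Psi> k (X \<omega>))"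
      using C f by (intro E_mono H H_add)
    also have "\<dots> \<le> E (\<lambda>\<omega>. \<Phi> k (X \<omega>)) + E (\<lambda>\<omega>. \<Psi> k (X \<omega>))"
      using C f by (intro E_subadd H)
    finally show ?thesis .
  qed
  moreover have "(\<lambda>k. E (\<lambda>\<omega>. \<Phi> k (X \<omega>)) + E (\<lambda>\<omega>. \<Psi> k (X \<omega>))) \<longlonglongrightarrow> extended_expectation E X \<phi> + 0"
    by (intro tendsto_add \<Psi> lLip_approximation_tendsto[OF X cont growth \<Phi>])
  ultimately show ?thesis
    using LIMSEQ_le_const by fastforce
qed

text \<open>Needed to know that, after conditioning, the inner expectation is again a function of
  the past to which \<open>E\<close> may be applied. The weight at \<open>s + x\<close> and
  \<open>t + x\<close> is at most a product of a weight in \<open>s\<close>, \<open>t\<close> and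
  one in \<open>x\<close>, so the expectation falls on \<open>g (X \<omega>)\<close> alone.\<close>

lemma C_lLip_expectation_shift:
  fixes X :: "'w \<Rightarrow> real ^ 'd"
  assumes X: "random_vector H X" and f: "f \<in> C_lLip"
  shows "(\<lambda>s. E (\<lambda>\<omega>. f (s + X \<omega>))) \<in> C_lLip"
proof -
  obtain C m where C: "0 \<le> C"
    and f': "\<And>n x y. m \<le> n \<Longrightarrow> \<bar>f x - f y\<bar> \<le> C * (1 + norm x + norm y) ^ n * norm (x - y)"
    using C_lLip_bound[OF f] by metis
  define g where "g x = (1 + 2 * norm x) ^ m" for x :: "real ^ 'd"
  have g: "g \<in> C_lLip"
    unfolding g_def by (intro C_lLip_power C_lLip_add C_lLip_mult C_lLip_const C_lLip_norm)
  note H = H_comp_random_vector[OF X]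
  have "\<bar>E (\<lambda>\<omega>. f (s + X \<omega>)) - E (\<lambda>\<omega>. f (t + X \<omega>))\<bar>
      \<le> (C * E (\<lambda>\<omega>. g (X \<omega>))) * (1 + norm s + norm t) ^ m * norm (s - t)" for s t
  proof -
    define c where "c = C * (1 + norm s + norm t) ^ m * norm (s - t)"
    have "0 \<le> c" using C by (simp add: c_def)
    have "\<bar>E (\<lambda>\<omega>. f (s + X \<omega>)) - E (\<lambda>\<omega>. f (t + X \<omega>))\<bar> \<le> E (\<lambda>\<omega>. c * g (X \<omega>))"
    proof (rule E_diff_le)
      show "(\<lambda>\<omega>. f (s + X \<omega>)) \<in> H" "(\<lambda>\<omega>. f (t + X \<omega>)) \<in> H"
        using H[OF C_lLip_shift[OF f]] by auto
      show "(\<lambda>\<omega>. c * g (X \<omega>)) \<in> H" using H[OF g] by (rule H_scale)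
      fix \<omega>
      let ?x = "X \<omega>"
      have "1 + norm (s + ?x) + norm (t + ?x) \<le> (1 + norm s + norm t) * (1 + 2 * norm ?x)"
      proof -
        have "1 + norm (s + ?x) + norm (t + ?x) \<le> 1 + norm s + norm t + 2 * norm ?x"
          using norm_triangle_ineq[of s ?x] norm_triangle_ineq[of t ?x] by linarith
        also have "\<dots> \<le> \<dots> + (norm s + norm t) * (2 * norm ?x)" by simp
        also have "\<dots> = (1 + norm s + norm t) * (1 + 2 * norm ?x)" by (simp add: algebra_simps)
        finally show ?thesis .
      qed
      then have "(1 + norm (s + ?x) + norm (t + ?x)) ^ m \<le> (1 + norm s + norm t) ^ m * g ?x"
        unfolding g_def by (subst power_mult_distrib[symmetric]) (intro power_mono, auto)
      then have "C * (1 + norm (s + ?x) + norm (t + ?x)) ^ m * norm (s - t)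
          \<le> C * ((1 + norm s + norm t) ^ m * g ?x) * norm (s - t)"
        using C by (intro mult_right_mono mult_left_mono) auto
      moreover have "\<bar>f (s + ?x) - f (t + ?x)\<bar> \<le> C * (1 + norm (s + ?x) + norm (t + ?x)) ^ m * norm (s - t)"
        using f'[of m "s + ?x" "t + ?x"] by simp
      ultimately show "\<bar>f (s + ?x) - f (t + ?x)\<bar> \<le> c * g ?x" by (simp add: c_def mult_ac)
    qed
    also have "\<dots> = c * E (\<lambda>\<omega>. g (X \<omega>))" using H[OF g] \<open>0 \<le> c\<close> by (rule E_pos_homogeneous)
    finally show ?thesis by (simp add: c_def mult_ac)
  qed
  then show ?thesis by (rule C_lLipI)
qed

end

subsection \<open>Partial sums of independent, identically distributed random vectors\<close>

text \<open>The sum is a linear function \<open>A\<close> of the tuple of all real components of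
  past and new vectors; once \<open>f\<close> composed with \<open>A\<close> is seen to lie in the
  tuple class, the definition of independence applies.\<close>

lemma E_independent_sum:
  fixes Y :: "nat \<Rightarrow> 'w \<Rightarrow> real ^ 'd"
  assumes ind: "independent_of_past E Y i" and f: "f \<in> C_lLip"
  shows "E (\<lambda>\<omega>. f (\<Sum>k=1..Suc i. Y k \<omega>)) =
    E (\<lambda>\<omega>. E (\<lambda>\<omega>'. f ((\<Sum>k=1..i. Y k \<omega>) + Y (Suc i) \<omega>')))"
proof -
  let ?I = "{1..i} \<times> (UNIV :: 'd set)"
  let ?J = "?I <+> (UNIV :: 'd set)"
  define A where "A z = (\<Sum>k=1..i. \<chi> j. z (Inl (k, j))) + (\<chi> j. z (Inr j))"
    for z :: "(nat \<times> 'd) + 'd \<Rightarrow> real"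
  have comp: "\<bar>z p\<bar> \<le> L2_set z ?J" if "p \<in> ?J" for z :: "(nat \<times> 'd) + 'd \<Rightarrow> real" and p
    using member_le_L2_set[OF _ that, of "\<lambda>p. \<bar>z p\<bar>"] by (simp add: L2_set_def)
  define d where "d = real CARD('d)"
  have "(\<lambda>z. f (A z)) \<in> C_lLip_on ?J"
  proof (rule C_lLip_on_compose[OF f])
    \<comment> \<open>Each of the \<open>i + 1\<close> vectors has \<open>d\<close> components, and
      each component is at most the norm of the whole tuple.\<close>
    show "0 \<le> real i * d + d" by (simp add: d_def)
    show "norm (A z) \<le> (real i * d + d) * L2_set z ?J" for z
    proof -
      have vec: "norm (\<chi> j. z (h j)) \<le> d * L2_set z ?J" if "\<And>j. h j \<in> ?J" for h :: "'d \<Rightarrow> _"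
      proof -
        have "norm (\<chi> j. z (h j)) \<le> (\<Sum>j\<in>UNIV. \<bar>(\<chi> j. z (h j)) $ j\<bar>)"
          by (rule norm_le_l1_cart)
        also have "\<dots> \<le> (\<Sum>j\<in>(UNIV::'d set). L2_set z ?J)"
          using comp that by (intro sum_mono) simp
        finally show ?thesis by (simp add: d_def)
      qed
      have "norm (A z) \<le> (\<Sum>k=1..i. norm (\<chi> j. z (Inl (k, j)))) + norm (\<chi> j. z (Inr j))"
        unfolding A_def by (intro norm_triangle_le add_mono norm_sum order_refl)
      also have "\<dots> \<le> (\<Sum>k=1..i. d * L2_set z ?J) + d * L2_set z ?J"
        by (intro add_mono sum_mono vec) auto
      finally show ?thesis by (simp add: algebra_simps)
    qed
    show "A z - A w = A (\<lambda>p. z p - w p)" for z w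
      unfolding A_def by (simp add: vec_eq_iff sum_subtractf)
  qed
  from bspec[OF ind[unfolded independent_of_past_def independent_from_def] this]
  show ?thesis by (simp add: A_def vec_nth_inverse)
qed

text \<open>The constant \<open>B\<close> may depend on \<open>e\<close>: it is fixed for
  \<open>e / 2\<close> before \<open>n\<close> is taken large.\<close>

lemma tendsto_of_error_bound:
  fixes a :: "nat \<Rightarrow> real"
  assumes "\<And>e. 0 < e \<Longrightarrow> \<exists>B. \<forall>n\<ge>1. \<bar>a n - l\<bar> \<le> e + B / real n"
  shows "a \<longlonglongrightarrow> l"
proof (rule LIMSEQ_I)
  fix e :: real assume "0 < e"
  then obtain B where B: "\<And>n. n \<ge> 1 \<Longrightarrow> \<bar>a n - l\<bar> \<le> e / 2 + B / real n"
    using assms[of "e / 2"] by auto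
  have "(\<lambda>n. B / real n) \<longlonglongrightarrow> 0" by (rule lim_const_over_n)
  then have "\<forall>\<^sub>F n in sequentially. B / real n < e / 2"
    using \<open>0 < e\<close> by (intro order_tendstoD(2)) auto
  then obtain N where N: "\<And>n. n \<ge> N \<Longrightarrow> B / real n < e / 2" by (auto simp: eventually_sequentially)
  have "norm (a n - l) < e" if "n \<ge> max 1 N" for n
    using B[of n] N[of n] that unfolding real_norm_def max.bounded_iff by linarith
  then show "\<exists>N. \<forall>n\<ge>N. norm (a n - l) < e" by blast
qed

section \<open>One-step estimates for partial sums and their iteration\<close>

context sublinear_expectation_space
begin

context
  fixes Y :: "nat \<Rightarrow> 'w \<Rightarrow> real ^ 'd"
  assumes rv: "\<And>i. 1 \<le> i \<Longrightarrow> random_vector H (Y i)"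
    and id: "\<And>i. 1 \<le> i \<Longrightarrow> identically_distributed E (Y (Suc i)) E (Y i)"
    and ind: "\<And>i. 1 \<le> i \<Longrightarrow> independent_of_past E Y i"
begin

lemma random_vector_partial_sum: "random_vector H (\<lambda>\<omega>. \<Sum>k=1..n. Y k \<omega>)"
  by (intro random_vector_sum rv) simp

lemma E_identical:
  assumes "f \<in> C_lLip"
  shows "E (\<lambda>\<omega>. f (Y (Suc i) \<omega>)) = E (\<lambda>\<omega>. f (Y 1 \<omega>))"
proof (induction i)
  case (Suc i)
  then show ?case using id[of "Suc i"] assms by (simp add: identically_distributed_def)
qed simp

text \<open>With the past frozen, the inner integrand is a shift of \<open>f\<close>, hence still in
  \<open>C_lLip\<close>, and the new vector can be replaced by \<open>Y 1\<close>. All one-step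
  estimates thus concern \<open>Y 1\<close> only.\<close>

lemma E_partial_sum_Suc:
  assumes f: "f \<in> C_lLip" and "1 \<le> i"
  shows "E (\<lambda>\<omega>. f (\<Sum>k=1..Suc i. Y k \<omega>)) = E (\<lambda>\<omega>. E (\<lambda>\<omega>'. f ((\<Sum>k=1..i. Y k \<omega>) + Y 1 \<omega>')))"
  by (simp only: E_independent_sum[OF ind[OF \<open>1 \<le> i\<close>] f] E_identical[OF C_lLip_shift[OF f]])

lemma inner_mem_H: "(\<lambda>\<omega>. p \<bullet> Y 1 \<omega>) \<in> H"
  by (rule H_comp_random_vector[OF rv]) (auto intro: C_lLip_linear bounded_linear_inner_right)

text \<open>If \<open>a\<close> is the point of \<open>G\<close> closest to \<open>s / k\<close> and \<open>b\<close> maximizes \<open>(s - k a) \<bullet> b\<close> over \<open>G\<close>, then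
  \<open>(k a + b) / (k + 1)\<close> is a competitor in \<open>G\<close> for the distance from \<open>(s + Y\<^sub>1) / (k + 1)\<close>, and the
  cross term in the expanded square has expectation at most zero.\<close>

lemma E_infdist_square_step:
  assumes G: "compact G" "convex G" "G \<noteq> {}"
    and support: "\<And>p. \<exists>b\<in>G. E (\<lambda>\<omega>. p \<bullet> Y 1 \<omega>) \<le> p \<bullet> b"
  shows "\<exists>C. \<forall>s k. (k = 0 \<longrightarrow> s = 0) \<longrightarrow>
    E (\<lambda>\<omega>. (real (Suc k) * infdist ((s + Y 1 \<omega>) /\<^sub>R real (Suc k)) G)\<^sup>2)
    \<le> (real k * infdist (s /\<^sub>R real k) G)\<^sup>2 + C"
proof -
  note H = H_comp_random_vector[OF rv[of 1]]
  obtain R where R: "\<And>x. x \<in> G \<Longrightarrow> norm x \<le> R"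
    using compact_imp_bounded[OF G(1)] bounded_iff by metis
  define V where "V = E (\<lambda>\<omega>. 2 * (norm (Y 1 \<omega>))\<^sup>2)"
  have HV: "(\<lambda>\<omega>. 2 * (norm (Y 1 \<omega>))\<^sup>2) \<in> H"
    by (intro H[of "\<lambda>x. 2 * (norm x)\<^sup>2"] C_lLip_mult C_lLip_const C_lLip_power C_lLip_norm order_refl)
  have "E (\<lambda>\<omega>. (real (Suc k) * infdist ((s + Y 1 \<omega>) /\<^sub>R real (Suc k)) G)\<^sup>2)
      \<le> (real k * infdist (s /\<^sub>R real k) G)\<^sup>2 + (2 * R\<^sup>2 + V)" if s: "k = 0 \<longrightarrow> s = 0" for s k
  proof -
    obtain a where a: "a \<in> G" "infdist (s /\<^sub>R real k) G = dist (s /\<^sub>R real k) a"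
      using infdist_attains_inf[OF compact_imp_closed[OF G(1)] G(3)] by metis
    define p where "p = s - real k *\<^sub>R a"
    obtain b where b: "b \<in> G" "E (\<lambda>\<omega>. p \<bullet> Y 1 \<omega>) \<le> p \<bullet> b" using support by blast
    \<comment> \<open>For \<open>k = 0\<close> the right side vanishes while \<open>p = s\<close>;
      the side condition on \<open>s\<close> settles this case.\<close>
    have p: "(norm p)\<^sup>2 = (real k * infdist (s /\<^sub>R real k) G)\<^sup>2"
    proof (cases "k = 0")
      case False
      then have "p = real k *\<^sub>R (s /\<^sub>R real k - a)" by (simp add: p_def scaleR_diff_right)
      then show ?thesis using False a by (simp add: dist_norm)
    qed (simp add: p_def s)
    \<comment> \<open>The deterministic terms are collected in \<open>?c\<close>, which leaves
      \<open>E\<close> exactly; only the two random terms are separated by subadditivity.\<close>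
    let ?c = "(norm p)\<^sup>2 - 2 * (p \<bullet> b) + 2 * R\<^sup>2"
    have pointwise: "(real (Suc k) * infdist ((s + y) /\<^sub>R real (Suc k)) G)\<^sup>2
        \<le> 2 * (p \<bullet> y) + 2 * (norm y)\<^sup>2 + ?c" for y
    proof -
      let ?a = "(real k / real (Suc k)) *\<^sub>R a + (1 / real (Suc k)) *\<^sub>R b"
      have "?a \<in> G" using a b G(2) by (intro convexD) (auto simp: field_simps)
      then have "real (Suc k) * infdist ((s + y) /\<^sub>R real (Suc k)) G
          \<le> real (Suc k) * dist ((s + y) /\<^sub>R real (Suc k)) ?a"
        by (intro mult_left_mono infdist_le) auto
      also have "\<dots> = norm (real (Suc k) *\<^sub>R ((s + y) /\<^sub>R real (Suc k) - ?a))"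
        by (simp add: dist_norm)
      also have "real (Suc k) *\<^sub>R ((s + y) /\<^sub>R real (Suc k) - ?a) = p + (y - b)"
        by (simp add: p_def scaleR_diff_right scaleR_add_right del: of_nat_Suc)
      finally have "(real (Suc k) * infdist ((s + y) /\<^sub>R real (Suc k)) G)\<^sup>2 \<le> (norm (p + (y - b)))\<^sup>2"
        by (intro power_mono) (auto simp: infdist_nonneg)
      also have "\<dots> = (norm p)\<^sup>2 + 2 * (p \<bullet> y) - 2 * (p \<bullet> b) + (norm (y - b))\<^sup>2"
        by (simp add: power2_norm_eq_inner inner_add_left inner_add_right inner_diff_left inner_diff_right
            inner_commute algebra_simps)
      also have "(norm (y - b))\<^sup>2 \<le> 2 * (norm y)\<^sup>2 + 2 * R\<^sup>2"
      proof -
        have "(norm (y - b))\<^sup>2 \<le> (norm y + R)\<^sup>2"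
          using norm_triangle_ineq4[of y b] R[OF b(1)] by (intro power_mono) auto
        moreover have "0 \<le> (norm y - R)\<^sup>2" by simp
        ultimately show ?thesis by (simp add: power2_sum power2_diff)
      qed
      finally show ?thesis by simp
    qed
    have H1: "(\<lambda>\<omega>. 2 * (p \<bullet> Y 1 \<omega>)) \<in> H" using inner_mem_H by (rule H_scale)
    have "(\<lambda>y. (real (Suc k) * infdist ((s + y) /\<^sub>R real (Suc k)) G)\<^sup>2) \<in> C_lLip"
      by (intro C_lLip_shift[of "\<lambda>y. (real (Suc k) * infdist (y /\<^sub>R real (Suc k)) G)\<^sup>2"] C_lLip_power
          C_lLip_mult C_lLip_const C_lLip_scaleR C_lLip_infdist)
    then have "E (\<lambda>\<omega>. (real (Suc k) * infdist ((s + Y 1 \<omega>) /\<^sub>R real (Suc k)) G)\<^sup>2)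
        \<le> E (\<lambda>\<omega>. 2 * (p \<bullet> Y 1 \<omega>) + 2 * (norm (Y 1 \<omega>))\<^sup>2 + ?c)"
      by (intro E_mono pointwise H_add H1 HV H_const)
        (rule H[of "\<lambda>y. (real (Suc k) * infdist ((s + y) /\<^sub>R real (Suc k)) G)\<^sup>2"], auto)
    also have "\<dots> = E (\<lambda>\<omega>. 2 * (p \<bullet> Y 1 \<omega>) + 2 * (norm (Y 1 \<omega>))\<^sup>2) + ?c"
      by (intro E_add_const H_add H1 HV)
    also have "\<dots> \<le> (E (\<lambda>\<omega>. 2 * (p \<bullet> Y 1 \<omega>)) + V) + ?c"
      unfolding V_def by (intro add_right_mono E_subadd H1 HV)
    also have "E (\<lambda>\<omega>. 2 * (p \<bullet> Y 1 \<omega>)) \<le> 2 * (p \<bullet> b)"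
      using E_pos_homogeneous[OF inner_mem_H, of 2 p] b(2) by simp
    finally show ?thesis using p by simp
  qed
  then show ?thesis by (intro exI[of _ "2 * R\<^sup>2 + V"] allI impI)
qed

text \<open>For \<open>k \<ge> 1\<close>, \<open>F k s\<close> is the squared distance from
  \<open>s\<close> to the dilate of \<open>G\<close> by \<open>k\<close>. Its expectation along the
  partial sums grows by at most \<open>C\<close> per step, and rescaling divides by
  \<open>n^2\<close>.\<close>

lemma E_infdist_mean_square_le:
  assumes G: "compact G" "convex G" "G \<noteq> {}"
    and support: "\<And>p. \<exists>b\<in>G. E (\<lambda>\<omega>. p \<bullet> Y 1 \<omega>) \<le> p \<bullet> b"
  shows "\<exists>C. \<forall>n\<ge>1. E (\<lambda>\<omega>. (infdist ((\<Sum>i=1..n. Y i \<omega>) /\<^sub>R real n) G)\<^sup>2) \<le> C / real n"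
proof -
  obtain C where C: "\<And>s k. (k = 0 \<longrightarrow> s = 0) \<Longrightarrow>
      E (\<lambda>\<omega>. (real (Suc k) * infdist ((s + Y 1 \<omega>) /\<^sub>R real (Suc k)) G)\<^sup>2)
      \<le> (real k * infdist (s /\<^sub>R real k) G)\<^sup>2 + C"
    using E_infdist_square_step[OF assms] by blast
  define F where "F k s = (real k * infdist (s /\<^sub>R real k) G)\<^sup>2" for k and s :: "real ^ 'd"
  have F: "F k \<in> C_lLip" for k
    unfolding F_def by (intro C_lLip_power C_lLip_mult C_lLip_const C_lLip_scaleR C_lLip_infdist)
  note step = C[folded F_def]
  note S = random_vector_partial_sum
  have "E (\<lambda>\<omega>. F (Suc n) (\<Sum>i=1..Suc n. Y i \<omega>)) \<le> real (Suc n) * C" for n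
  proof (induction n)
    case 0
    \<comment> \<open>The first summand is reached from the empty sum by the one-step estimate at
      \<open>k = 0\<close>, as independence is available only from index \<open>1\<close>
      on.\<close>
    show ?case using step[of 0 0] by (simp add: F_def)
  next
    case (Suc n)
    let ?S = "\<lambda>\<omega>. \<Sum>i=1..Suc n. Y i \<omega>"
    have "E (\<lambda>\<omega>. F (Suc (Suc n)) (\<Sum>i=1..Suc (Suc n). Y i \<omega>))
        = E (\<lambda>\<omega>. E (\<lambda>\<omega>'. F (Suc (Suc n)) (?S \<omega> + Y 1 \<omega>')))"
      by (rule E_partial_sum_Suc[OF F]) simp
    also have "\<dots> \<le> E (\<lambda>\<omega>. F (Suc n) (?S \<omega>) + C)"
    proof (rule E_mono)
      show "(\<lambda>\<omega>. F (Suc n) (?S \<omega>) + C) \<in> H"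
        using H_comp_random_vector[OF S F] H_const by (rule H_add)
      show "(\<lambda>\<omega>. E (\<lambda>\<omega>'. F (Suc (Suc n)) (?S \<omega> + Y 1 \<omega>'))) \<in> H"
        using H_comp_random_vector[OF S C_lLip_expectation_shift[OF rv[OF order_refl] F]] .
      show "E (\<lambda>\<omega>'. F (Suc (Suc n)) (?S \<omega> + Y 1 \<omega>')) \<le> F (Suc n) (?S \<omega>) + C" for \<omega>
        using step[of "Suc n" "?S \<omega>"] by simp
    qed
    also have "\<dots> = E (\<lambda>\<omega>. F (Suc n) (?S \<omega>)) + C"
      using H_comp_random_vector[OF S F] by (rule E_add_const)
    also have "\<dots> \<le> real (Suc (Suc n)) * C" using Suc by (simp add: algebra_simps)
    finally show ?case .
  qed
  then have *: "E (\<lambda>\<omega>. F n (\<Sum>i=1..n. Y i \<omega>)) \<le> real n * C" if "1 \<le> n" for n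
    using that by (cases n) auto
  have "E (\<lambda>\<omega>. (infdist ((\<Sum>i=1..n. Y i \<omega>) /\<^sub>R real n) G)\<^sup>2) \<le> C / real n" if "1 \<le> n" for n
  proof -
    have "E (\<lambda>\<omega>. (infdist ((\<Sum>i=1..n. Y i \<omega>) /\<^sub>R real n) G)\<^sup>2)
        = E (\<lambda>\<omega>. inverse ((real n)\<^sup>2) * F n (\<Sum>i=1..n. Y i \<omega>))"
      using that by (simp add: F_def power_mult_distrib flip: mult.assoc)
    also have "\<dots> = inverse ((real n)\<^sup>2) * E (\<lambda>\<omega>. F n (\<Sum>i=1..n. Y i \<omega>))"
      using H_comp_random_vector[OF S F] by (rule E_pos_homogeneous) simp
    also have "\<dots> \<le> inverse ((real n)\<^sup>2) * (real n * C)"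
      using *[OF that] by (intro mult_left_mono) auto
    also have "\<dots> = C / real n" using that by (simp add: power2_eq_square field_simps)
    finally show ?thesis .
  qed
  then show ?thesis by blast
qed

text \<open>When the square is expanded around \<open>q\<close>, the linear term
  \<open>- 2 p \<bullet> (y - q)\<close> has nonnegative expectation by the hypothesis at
  \<open>- 2 p\<close>. Each step therefore loses at most \<open>C\<close>, and rescaling by
  \<open>n^2\<close> leaves \<open>C / n\<close>.\<close>

lemma E_dist_mean_square_ge:
  assumes q: "\<And>p. p \<bullet> q \<le> E (\<lambda>\<omega>. p \<bullet> Y 1 \<omega>)"
  shows "\<exists>C. \<forall>n\<ge>1. - C / real n \<le> E (\<lambda>\<omega>. - (norm ((\<Sum>i=1..n. Y i \<omega>) /\<^sub>R real n - q))\<^sup>2)"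
proof -
  define F where "F k s = - (norm (s - real k *\<^sub>R q))\<^sup>2" for k and s :: "real ^ 'd"
  have F: "F k \<in> C_lLip" for k
    unfolding F_def by (intro C_lLip_uminus C_lLip_power C_lLip_norm_diff)
  note S = random_vector_partial_sum
  define C where "C = E (\<lambda>\<omega>. (norm (Y 1 \<omega> - q))\<^sup>2)"
  note H = H_comp_random_vector[OF rv[of 1, OF order_refl]]
  have HC: "(\<lambda>\<omega>. (norm (Y 1 \<omega> - q))\<^sup>2) \<in> H" by (rule H[OF C_lLip_power[OF C_lLip_norm_diff]])
  have step: "F k s - C \<le> E (\<lambda>\<omega>. F (Suc k) (s + Y 1 \<omega>))" for s k
  proof -
    define p where "p = s - real k *\<^sub>R q"
    \<comment> \<open>The square \<open>(norm (y - q))^2\<close> is moved next to \<open>F\<close>,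
      so that subadditivity, which only bounds the expectation of a sum from above, yields a lower
      bound for the expectation of \<open>F\<close>.\<close>
    have eq: "(- 2 *\<^sub>R p) \<bullet> y + (2 * (p \<bullet> q) - (norm p)\<^sup>2) = F (Suc k) (s + y) + (norm (y - q))\<^sup>2" for y
    proof -
      have "s + y - real (Suc k) *\<^sub>R q = p + (y - q)" by (simp add: p_def algebra_simps)
      then show ?thesis unfolding F_def
        by (simp add: power2_norm_eq_inner inner_add_left inner_add_right inner_diff_left inner_diff_right
            inner_commute algebra_simps)
    qed
    have "F k s = (- 2 *\<^sub>R p) \<bullet> q + (2 * (p \<bullet> q) - (norm p)\<^sup>2)" by (simp add: F_def p_def)
    also have "\<dots> \<le> E (\<lambda>\<omega>. (- 2 *\<^sub>R p) \<bullet> Y 1 \<omega>) + (2 * (p \<bullet> q) - (norm p)\<^sup>2)"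
      by (intro add_right_mono q)
    also have "\<dots> = E (\<lambda>\<omega>. (- 2 *\<^sub>R p) \<bullet> Y 1 \<omega> + (2 * (p \<bullet> q) - (norm p)\<^sup>2))"
      by (rule E_add_const[OF inner_mem_H, symmetric])
    also have "\<dots> = E (\<lambda>\<omega>. F (Suc k) (s + Y 1 \<omega>) + (norm (Y 1 \<omega> - q))\<^sup>2)"
      by (simp only: eq)
    also have "\<dots> \<le> E (\<lambda>\<omega>. F (Suc k) (s + Y 1 \<omega>)) + C"
      unfolding C_def by (intro E_subadd HC H[OF C_lLip_shift[OF F]])
    finally show ?thesis by simp
  qed
  have "- real (Suc n) * C \<le> E (\<lambda>\<omega>. F (Suc n) (\<Sum>i=1..Suc n. Y i \<omega>))" for n
  proof (induction n)
    case 0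
    show ?case using step[of 0 0] by (simp add: F_def)
  next
    case (Suc n)
    let ?S = "\<lambda>\<omega>. \<Sum>i=1..Suc n. Y i \<omega>"
    have "- real (Suc (Suc n)) * C \<le> E (\<lambda>\<omega>. F (Suc n) (?S \<omega>)) + - C"
      using Suc by (simp add: algebra_simps)
    also have "\<dots> = E (\<lambda>\<omega>. F (Suc n) (?S \<omega>) + - C)"
      using H_comp_random_vector[OF S F] by (rule E_add_const[symmetric])
    also have "\<dots> \<le> E (\<lambda>\<omega>. E (\<lambda>\<omega>'. F (Suc (Suc n)) (?S \<omega> + Y 1 \<omega>')))"
    proof (rule E_mono)
      show "(\<lambda>\<omega>. F (Suc n) (?S \<omega>) + - C) \<in> H"
        using H_comp_random_vector[OF S F] H_const by (rule H_add)
      show "(\<lambda>\<omega>. E (\<lambda>\<omega>'. F (Suc (Suc n)) (?S \<omega> + Y 1 \<omega>'))) \<in> H"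
        using H_comp_random_vector[OF S C_lLip_expectation_shift[OF rv[OF order_refl] F]] .
      show "F (Suc n) (?S \<omega>) + - C \<le> E (\<lambda>\<omega>'. F (Suc (Suc n)) (?S \<omega> + Y 1 \<omega>'))" for \<omega>
        using step[of "Suc n" "?S \<omega>"] by simp
    qed
    also have "\<dots> = E (\<lambda>\<omega>. F (Suc (Suc n)) (\<Sum>i=1..Suc (Suc n). Y i \<omega>))"
      by (rule E_partial_sum_Suc[OF F, symmetric]) simp
    finally show ?case .
  qed
  then have *: "- real n * C \<le> E (\<lambda>\<omega>. F n (\<Sum>i=1..n. Y i \<omega>))" if "1 \<le> n" for n
    using that by (cases n) auto
  have "- C / real n \<le> E (\<lambda>\<omega>. - (norm ((\<Sum>i=1..n. Y i \<omega>) /\<^sub>R real n - q))\<^sup>2)" if "1 \<le> n" for n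
  proof -
    have scaled: "inverse ((real n)\<^sup>2) * F n s = - (norm (s /\<^sub>R real n - q))\<^sup>2" for s
    proof -
      have "s /\<^sub>R real n - q = (s - real n *\<^sub>R q) /\<^sub>R real n"
        using that by (simp add: scaleR_diff_right)
      then show ?thesis by (simp add: F_def power_mult_distrib power_inverse)
    qed
    have "- C / real n = inverse ((real n)\<^sup>2) * (- real n * C)"
      using that by (simp add: power2_eq_square field_simps)
    also have "\<dots> \<le> inverse ((real n)\<^sup>2) * E (\<lambda>\<omega>. F n (\<Sum>i=1..n. Y i \<omega>))"
      using *[OF that] by (intro mult_left_mono) auto
    also have "\<dots> = E (\<lambda>\<omega>. inverse ((real n)\<^sup>2) * F n (\<Sum>i=1..n. Y i \<omega>))"
      using H_comp_random_vector[OF S F] by (rule E_pos_homogeneous[symmetric]) simp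
    also have "\<dots> = E (\<lambda>\<omega>. - (norm ((\<Sum>i=1..n. Y i \<omega>) /\<^sub>R real n - q))\<^sup>2)"
      by (simp only: scaled)
    finally show ?thesis .
  qed
  then show ?thesis by blast
qed

text \<open>The two \<open>support\<close> hypotheses say that \<open>G\<close> has the support
  function of \<open>Y 1\<close>. The first feeds the upper estimate through the distance to
  \<open>G\<close>, the second the lower estimate at the maximizer \<open>q\<close>.\<close>

lemma extended_expectation_mean_tendsto:
  assumes G: "compact G" "convex G"
    and support: "\<And>p. \<exists>b\<in>G. E (\<lambda>\<omega>. p \<bullet> Y 1 \<omega>) \<le> p \<bullet> b"
      "\<And>p q. q \<in> G \<Longrightarrow> p \<bullet> q \<le> E (\<lambda>\<omega>. p \<bullet> Y 1 \<omega>)"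
    and cont: "continuous_on UNIV \<phi>" and growth: "\<And>x. \<bar>\<phi> x\<bar> \<le> C * (1 + norm x)"
    and q: "q \<in> G" "\<And>x. x \<in> G \<Longrightarrow> \<phi> x \<le> \<phi> q"
  shows "(\<lambda>n. extended_expectation E (\<lambda>\<omega>. (1 / real n) *\<^sub>R (\<Sum>i=1..n. Y i \<omega>)) \<phi>) \<longlonglongrightarrow> \<phi> q"
proof (rule tendsto_of_error_bound)
  fix e :: real assume "0 < e"
  let ?X = "\<lambda>n \<omega>. (1 / real n) *\<^sub>R (\<Sum>i=1..n. Y i \<omega>)"
  have X: "random_vector H (?X n)" for n
    by (rule random_vector_scaleR[OF random_vector_partial_sum])
  note H = H_comp_random_vector[OF X]
  have ne: "G \<noteq> {}" using q by auto
  obtain K where K: "0 \<le> K" "\<And>x. \<phi> x \<le> \<phi> q + e + K * (infdist x G)\<^sup>2"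
    using le_infdist_square[OF cont growth G(1) ne q(2) \<open>0 < e\<close>] by blast
  obtain L where L: "0 \<le> L" "\<And>x. L * - (norm (x - q))\<^sup>2 + (\<phi> q - e) \<le> \<phi> x"
    using ge_dist_square[OF cont growth \<open>0 < e\<close>, of q] by blast
  obtain A where A: "\<And>n. 1 \<le> n \<Longrightarrow> E (\<lambda>\<omega>. (infdist (?X n \<omega>) G)\<^sup>2) \<le> A / real n"
    using E_infdist_mean_square_le[OF G ne support(1)] by (auto simp: divide_inverse)
  obtain B where B: "\<And>n. 1 \<le> n \<Longrightarrow> - B / real n \<le> E (\<lambda>\<omega>. - (norm (?X n \<omega> - q))\<^sup>2)"
    using E_dist_mean_square_ge[OF support(2)[OF q(1)]] by (auto simp: divide_inverse)
  \<comment> \<open>The signs of \<open>A\<close> and \<open>B\<close> are unknown; absolute values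
    allow one error term to serve both directions.\<close>
  have "\<bar>extended_expectation E (?X n) \<phi> - \<phi> q\<bar> \<le> e + (\<bar>K * A\<bar> + \<bar>L * B\<bar>) / real n" if n: "1 \<le> n" for n
  proof -
    have F: "(\<lambda>x. (infdist x G)\<^sup>2) \<in> C_lLip" by (intro C_lLip_power C_lLip_infdist)
    have F': "(\<lambda>x. - (norm (x - q))\<^sup>2) \<in> C_lLip"
      by (intro C_lLip_uminus C_lLip_power C_lLip_norm_diff)
    have "extended_expectation E (?X n) \<phi> \<le> E (\<lambda>\<omega>. K * (infdist (?X n \<omega>) G)\<^sup>2 + (\<phi> q + e))"
      by (rule extended_expectation_le[OF X cont growth])
        (use K F in \<open>auto simp: algebra_simps intro!: C_lLip_add C_lLip_mult C_lLip_const\<close>)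
    also have "\<dots> = K * E (\<lambda>\<omega>. (infdist (?X n \<omega>) G)\<^sup>2) + (\<phi> q + e)"
      by (simp only: E_add_const[OF H_scale[OF H[OF F]]] E_pos_homogeneous[OF H[OF F] K(1)])
    also have "\<dots> \<le> K * (A / real n) + (\<phi> q + e)"
      using A[OF n] K(1) by (intro add_right_mono mult_left_mono)
    also have "\<dots> \<le> \<bar>K * A\<bar> / real n + (\<phi> q + e)" by (simp add: divide_right_mono)
    finally have 1: "extended_expectation E (?X n) \<phi> \<le> \<bar>K * A\<bar> / real n + (\<phi> q + e)" .
    have "- (\<bar>L * B\<bar> / real n) + (\<phi> q - e) \<le> L * (- B / real n) + (\<phi> q - e)"
      by (simp add: divide_right_mono)
    also have "\<dots> \<le> L * E (\<lambda>\<omega>. - (norm (?X n \<omega> - q))\<^sup>2) + (\<phi> q - e)"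
      using B[OF n] L(1) by (intro add_right_mono mult_left_mono)
    also have "\<dots> = E (\<lambda>\<omega>. L * (- (norm (?X n \<omega> - q))\<^sup>2) + (\<phi> q - e))"
      by (simp only: E_add_const[OF H_scale[OF H[OF F']]] E_pos_homogeneous[OF H[OF F'] L(1)])
    also have "\<dots> \<le> extended_expectation E (?X n) \<phi>"
    proof (rule extended_expectation_ge[OF X cont growth])
      show "(\<lambda>x. L * - (norm (x - q))\<^sup>2 + (\<phi> q - e)) \<in> C_lLip"
        by (intro C_lLip_add C_lLip_mult C_lLip_const F')
      show "L * - (norm (x - q))\<^sup>2 + (\<phi> q - e) \<le> \<phi> x" for x by (rule L(2))
    qed
    finally have 2: "- (\<bar>L * B\<bar> / real n) + (\<phi> q - e) \<le> extended_expectation E (?X n) \<phi>" .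
    have "0 \<le> \<bar>K * A\<bar> / real n" "0 \<le> \<bar>L * B\<bar> / real n" by simp_all
    with 1 2 show ?thesis unfolding add_divide_distrib by linarith
  qed
  then show "\<exists>B. \<forall>n\<ge>1. \<bar>extended_expectation E (?X n) \<phi> - \<phi> q\<bar> \<le> e + B / real n" by blast
qed

end

end

subsection \<open>Maximal distributions\<close>

text \<open>The maximum property is given only on \<open>C_lLip\<close>. It extends to
  \<open>\<phi>\<close> through the same quadratic bounds from above and below, which lie in that
  class and are within \<open>e\<close> of \<open>\<phi> q\<close> at the relevant points.\<close>

lemma (in sublinear_expectation_space) extended_expectation_maximal:
  fixes \<eta> :: "'w \<Rightarrow> real ^ 'd"
  assumes \<eta>: "random_vector H \<eta>" and G: "compact G"
    and max: "\<And>\<phi>. \<phi> \<in> C_lLip \<Longrightarrow> E (\<lambda>\<omega>. \<phi> (\<eta> \<omega>)) \<in> \<phi> ` G"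
      "\<And>\<phi> y. \<phi> \<in> C_lLip \<Longrightarrow> y \<in> G \<Longrightarrow> \<phi> y \<le> E (\<lambda>\<omega>. \<phi> (\<eta> \<omega>))"
    and cont: "continuous_on UNIV \<phi>" and growth: "\<And>x. \<bar>\<phi> x\<bar> \<le> C * (1 + norm x)"
    and q: "q \<in> G" "\<And>x. x \<in> G \<Longrightarrow> \<phi> x \<le> \<phi> q"
  shows "extended_expectation E \<eta> \<phi> = \<phi> q"
proof (rule antisym)
  have ne: "G \<noteq> {}" using q by auto
  show "extended_expectation E \<eta> \<phi> \<le> \<phi> q"
  proof (rule field_le_epsilon)
    fix e :: real assume "0 < e"
    obtain K where K: "0 \<le> K" "\<And>x. \<phi> x \<le> \<phi> q + e + K * (infdist x G)\<^sup>2"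
      using le_infdist_square[OF cont growth G ne q(2) \<open>0 < e\<close>] by blast
    let ?f = "\<lambda>x. \<phi> q + e + K * (infdist x G)\<^sup>2"
    have f: "?f \<in> C_lLip" by (intro C_lLip_add C_lLip_mult C_lLip_const C_lLip_power C_lLip_infdist)
    have "extended_expectation E \<eta> \<phi> \<le> E (\<lambda>\<omega>. ?f (\<eta> \<omega>))"
      using extended_expectation_le[OF \<eta> cont growth f K(2)] .
    \<comment> \<open>The expectation is a value of \<open>?f\<close> on \<open>G\<close>, where the
      distance term vanishes.\<close>
    also have "\<dots> = \<phi> q + e" using max(1)[OF f] by auto
    finally show "extended_expectation E \<eta> \<phi> \<le> \<phi> q + e" .
  qed
  show "\<phi> q \<le> extended_expectation E \<eta> \<phi>"
  proof (rule field_le_epsilon)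
    fix e :: real assume "0 < e"
    obtain L where L: "\<And>x. L * - (norm (x - q))\<^sup>2 + (\<phi> q - e) \<le> \<phi> x"
      using ge_dist_square[OF cont growth \<open>0 < e\<close>, of q] by blast
    let ?f = "\<lambda>x. L * - (norm (x - q))\<^sup>2 + (\<phi> q - e)"
    have f: "?f \<in> C_lLip"
      by (intro C_lLip_add C_lLip_mult C_lLip_const C_lLip_uminus C_lLip_power C_lLip_norm_diff)
    have "\<phi> q - e = ?f q" by simp
    also have "\<dots> \<le> E (\<lambda>\<omega>. ?f (\<eta> \<omega>))" using max(2)[OF f q(1)] .
    also have "\<dots> \<le> extended_expectation E \<eta> \<phi>"
      using extended_expectation_ge[OF \<eta> cont growth f L] .
    finally show "\<phi> q \<le> extended_expectation E \<eta> \<phi> + e" by simp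
  qed
qed

section \<open>Existence of a maximal distribution with a given support function\<close>

text \<open>A Hahn-Banach statement: separate \<open>(p, g p)\<close> from the strict epigraph of \<open>g\<close>.\<close>

lemma ex_subgradient:
  fixes g :: "'a::euclidean_space \<Rightarrow> real"
  assumes add: "\<And>p q. g (p + q) \<le> g p + g q" and scale: "\<And>c p. 0 \<le> c \<Longrightarrow> g (c *\<^sub>R p) = c * g p"
  shows "\<exists>q. (\<forall>r. r \<bullet> q \<le> g r) \<and> p \<bullet> q = g p"
proof -
  let ?S = "{(r, t). g r < t}"
  have "convex ?S"
  proof (rule convexI)
    fix x y :: "'a \<times> real" and u v :: real
    assume x: "x \<in> ?S" and y: "y \<in> ?S" and uv: "0 \<le> u" "0 \<le> v" "u + v = 1"
    have "g (u *\<^sub>R fst x + v *\<^sub>R fst y) \<le> u * g (fst x) + v * g (fst y)"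
      using add[of "u *\<^sub>R fst x" "v *\<^sub>R fst y"] scale uv by simp
    also have "\<dots> < u * snd x + v * snd y"
    \<comment> \<open>A zero weight destroys strictness, so the strict inequality is taken from a
      point whose weight is positive.\<close>
    proof (cases "u = 0")
      case False
      then have "u * g (fst x) < u * snd x" using x uv by auto
      moreover have "v * g (fst y) \<le> v * snd y" using y uv by (auto intro: mult_left_mono)
      ultimately show ?thesis by simp
    qed (use uv y in auto)
    finally show "u *\<^sub>R x + v *\<^sub>R y \<in> ?S" by (auto simp: case_prod_beta)
  qed
  moreover have "(0, g 0 + 1) \<in> ?S" by simp
  then have "?S \<noteq> {}" by blast
  moreover have "?S \<inter> {(p, g p)} = {}" by auto
  ultimately obtain a b where "a \<noteq> 0" "\<forall>x\<in>?S. inner a x \<le> b" "\<forall>x\<in>{(p, g p)}. b \<le> inner a x"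
    using separating_hyperplane_sets[of ?S "{(p, g p)}"] convex_singleton by blast
  then have ab: "a \<noteq> 0" "\<And>x. x \<in> ?S \<Longrightarrow> inner a x \<le> b" "b \<le> inner a (p, g p)" by blast+
  obtain u s where a: "a = (u, s)" by (cases a)
  have le: "u \<bullet> r + s * t \<le> u \<bullet> p + s * g p" if "g r < t" for r t
    using ab(2)[of "(r, t)"] ab(3) that by (simp add: a)
  \<comment> \<open>The hyperplane cannot be vertical, because \<open>g\<close> is finite
    everywhere: the point above \<open>p + u\<close> would force \<open>u = 0\<close>.\<close>
  have "s \<noteq> 0"
  proof
    assume "s = 0"
    then have "u \<bullet> (p + u) \<le> u \<bullet> p" using le[of "p + u" "g (p + u) + 1"] by simp
    then have "u \<bullet> u \<le> 0" by (simp add: inner_add_right)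
    then have "u = 0" using inner_gt_zero_iff[of u] by linarith
    with \<open>s = 0\<close> ab(1) a show False by (simp add: zero_prod_def)
  qed
  moreover have "s \<le> 0" using le[of p "g p + 1"] by (simp add: algebra_simps)
  ultimately have s: "s < 0" by simp
  define q where "q = (1 / (- s)) *\<^sub>R u"
  have q: "r \<bullet> q - g r \<le> p \<bullet> q - g p" for r
  proof (rule field_le_epsilon)
    fix e :: real assume "0 < e"
    have "(u \<bullet> r + s * (g r + e)) / (- s) \<le> (u \<bullet> p + s * g p) / (- s)"
      using le[of r "g r + e"] s \<open>0 < e\<close> by (intro divide_right_mono) auto
    moreover have "(u \<bullet> r + s * (g r + e)) / (- s) = r \<bullet> q - (g r + e)"
      "(u \<bullet> p + s * g p) / (- s) = p \<bullet> q - g p"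
      using s by (simp_all add: q_def inner_commute field_simps)
    ultimately show "r \<bullet> q - g r \<le> p \<bullet> q - g p + e" by simp
  qed
  have g0: "g 0 = 0" using scale[of 0 0] by simp
  \<comment> \<open>So far \<open>q\<close> only gives an affine support at \<open>p\<close>.
    Testing at \<open>0\<close> and at \<open>2 p\<close> and using homogeneity removes the
    constant.\<close>
  have "0 \<le> p \<bullet> q - g p" using q[of 0] g0 by simp
  moreover have "p \<bullet> q - g p \<le> 0" using q[of "2 *\<^sub>R p"] scale[of 2 p] by simp
  ultimately have "p \<bullet> q = g p" by simp
  moreover have "r \<bullet> q \<le> g r" for r using q[of r] \<open>p \<bullet> q = g p\<close> by simp
  ultimately show ?thesis by blast
qed

text \<open>The supremum over \<open>G\<close> is the upper expectation of the family of point
  masses on \<open>G\<close>; functions bounded on \<open>G\<close> are the natural domain, as their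
  suprema are finite and composition with \<open>C_lLip_on\<close> preserves boundedness.\<close>

lemma sublinear_expectation_space_SUP:
  assumes G: "bounded G" "G \<noteq> {}"
  shows "sublinear_expectation_space {f. bounded (f ` G)} (\<lambda>f. SUP x\<in>G. f x)"
proof
  fix X Y :: "'a \<Rightarrow> real" and c :: real
  have B: "\<exists>b. \<forall>x\<in>G. \<bar>f x\<bar> \<le> b" if "f \<in> {f. bounded (f ` G)}" for f :: "'a \<Rightarrow> real"
    using that by (auto simp: bounded_iff)
  have bdd: "bdd_above (f ` G)" if "f \<in> {f. bounded (f ` G)}" for f :: "'a \<Rightarrow> real"
    using that by (auto intro: bounded_imp_bdd_above)
  have add: "(\<lambda>\<omega>. X \<omega> + Y \<omega>) \<in> {f. bounded (f ` G)}"
    if XY: "X \<in> {f. bounded (f ` G)}" "Y \<in> {f. bounded (f ` G)}" for X Y :: "'a \<Rightarrow> real"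
    using that by (auto intro: bounded_plus_comp)
  show "(\<lambda>\<omega>. c) \<in> {f. bounded (f ` G)}" by (auto simp: bounded_iff)
  show "(SUP x\<in>G. c) = c" using G by simp
  show "(\<lambda>\<omega>. c * X \<omega>) \<in> {f. bounded (f ` G)}" if X: "X \<in> {f. bounded (f ` G)}"
    using bounded_scaling[of "X ` G" c] X by (simp add: image_image)
  show "(\<lambda>\<omega>. \<bar>X \<omega>\<bar>) \<in> {f. bounded (f ` G)}" if X: "X \<in> {f. bounded (f ` G)}"
    using B[OF X] by (auto simp: bounded_iff)
  show "(\<lambda>\<omega>. X \<omega> + Y \<omega>) \<in> {f. bounded (f ` G)}"
    if "X \<in> {f. bounded (f ` G)}" "Y \<in> {f. bounded (f ` G)}"
    using add that .
  show "(SUP x\<in>G. Y x) \<le> (SUP x\<in>G. X x)"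
    if "X \<in> {f. bounded (f ` G)}" "Y \<in> {f. bounded (f ` G)}" "\<And>\<omega>. Y \<omega> \<le> X \<omega>"
    using that G by (intro cSUP_mono bdd) auto
  show "(SUP x\<in>G. X x + Y x) \<le> (SUP x\<in>G. X x) + (SUP x\<in>G. Y x)"
    if "X \<in> {f. bounded (f ` G)}" "Y \<in> {f. bounded (f ` G)}"
    using that G by (intro cSUP_least add_mono cSUP_upper bdd) auto
  show "(SUP x\<in>G. c * X x) = c * (SUP x\<in>G. X x)" if X: "X \<in> {f. bounded (f ` G)}" and c: "0 \<le> c"
  proof -
    have "c * (SUP x\<in>G. X x) = (SUP y\<in>X ` G. c * y)"
      using G c by (intro continuous_at_Sup_mono[of "\<lambda>y. c * y"] monoI mult_left_mono bdd X)
        (auto intro!: continuous_intros)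
    then show ?thesis by (simp add: image_image)
  qed
next
  fix n :: nat and \<phi> :: "(nat \<Rightarrow> real) \<Rightarrow> real" and Z :: "nat \<Rightarrow> 'a \<Rightarrow> real"
  assume \<phi>: "\<phi> \<in> C_lLip_on {..<n}" and Z: "\<And>i. i < n \<Longrightarrow> Z i \<in> {f. bounded (f ` G)}"
  obtain C m where C: "\<And>x y. \<bar>\<phi> x - \<phi> y\<bar> \<le> C * (1 + L2_set x {..<n} + L2_set y {..<n}) ^ m *
      L2_set (\<lambda>i. x i - y i) {..<n}"
    using \<phi> unfolding C_lLip_on_iff by blast
  have "\<forall>i. \<exists>b. i < n \<longrightarrow> (\<forall>x\<in>G. \<bar>Z i x\<bar> \<le> b)" using Z by (auto simp: bounded_iff)
  then obtain b where b: "\<And>i x. i < n \<Longrightarrow> x \<in> G \<Longrightarrow> \<bar>Z i x\<bar> \<le> b i" by metis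
  define L where "L = (\<Sum>i<n. b i)"
  have L: "L2_set (\<lambda>i. Z i x) {..<n} \<le> L" if "x \<in> G" for x
    using L2_set_le_sum_abs[of "\<lambda>i. Z i x" "{..<n}"] sum_mono[of "{..<n}" "\<lambda>i. \<bar>Z i x\<bar>" b] b that
    by (simp add: L_def)
  have "\<bar>\<phi> (\<lambda>i. Z i x)\<bar> \<le> \<bar>\<phi> (\<lambda>i. 0)\<bar> + \<bar>C\<bar> * (1 + L) ^ m * L" if "x \<in> G" for x
  proof -
    let ?l = "L2_set (\<lambda>i. Z i x) {..<n}"
    have "0 \<le> ?l" by (rule L2_set_nonneg)
    have "\<bar>\<phi> (\<lambda>i. Z i x) - \<phi> (\<lambda>i. 0)\<bar> \<le> C * (1 + ?l) ^ m * ?l"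
      using C[of "\<lambda>i. Z i x" "\<lambda>i. 0"] by (simp add: L2_set_def)
    also have "\<dots> \<le> \<bar>C\<bar> * (1 + L) ^ m * L"
      using L[OF that] \<open>0 \<le> ?l\<close> order_trans[OF \<open>0 \<le> ?l\<close> L[OF that]]
      by (intro mult_mono power_mono mult_nonneg_nonneg zero_le_power) auto
    finally show ?thesis by linarith
  qed
  then show "(\<lambda>\<omega>. \<phi> (\<lambda>i. Z i \<omega>)) \<in> {f. bounded (f ` G)}" by (auto simp: bounded_iff)
qed

text \<open>\<open>G\<close> is the subdifferential of \<open>g\<close> at the origin and
  \<open>\<eta>\<close> the identity under the supremum over \<open>G\<close>. The linear bound
  makes \<open>G\<close> bounded, and \<open>ex_subgradient\<close> shows that its support function
  is all of \<open>g\<close>.\<close>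

lemma ex_maximal_distributed:
  fixes g :: "real ^ 'd \<Rightarrow> real"
  assumes add: "\<And>p q. g (p + q) \<le> g p + g q" and scale: "\<And>c p. 0 \<le> c \<Longrightarrow> g (c *\<^sub>R p) = c * g p"
    and bound: "\<And>p. g p \<le> B * norm p"
  shows "\<exists>(H :: (real ^ 'd \<Rightarrow> real) set) E (\<eta> :: real ^ 'd \<Rightarrow> real ^ 'd).
    sublinear_expectation_space H E \<and> maximal_distributed H E \<eta> \<and> sublinear_function E \<eta> = g"
proof -
  define G where "G = {q. \<forall>p. p \<bullet> q \<le> g p}"
  have sub: "\<exists>q\<in>G. p \<bullet> q = g p" for p
    using ex_subgradient[of g p] add scale unfolding G_def by blast
  have ne: "G \<noteq> {}" using sub by blast
  have norm_le: "norm q \<le> B" if "q \<in> G" for q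
  proof (cases "q = 0")
    case True
    \<comment> \<open>For \<open>q = 0\<close> the claim is \<open>0 \<le> B\<close>, read off from
      \<open>0 \<le> g p \<le> B\<close> at a unit vector \<open>p\<close>.\<close>
    have "0 \<le> g (axis undefined 1)" using that by (simp add: G_def True)
    then have "0 \<le> B" using bound[of "axis undefined 1"] by simp
    then show ?thesis using True by simp
  next
    case False
    have "q \<bullet> q \<le> B * norm q" using that bound[of q] unfolding G_def by (blast intro: order_trans)
    then show ?thesis using False by (simp add: dot_square_norm power2_eq_square)
  qed
  have bdd: "bounded G" using norm_le by (auto simp: bounded_iff)
  have G_eq: "G = (\<Inter>p. {q. p \<bullet> q \<le> g p})" by (auto simp: G_def)
  have closed: "closed G" unfolding G_eq by (intro closed_INT ballI closed_halfspace_le)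
  have convex: "convex G" unfolding G_eq by (intro convex_INT convex_halfspace_le)
  have compact: "compact G" using bdd closed by (simp add: compact_eq_bounded_closed)
  let ?H = "{f. bounded (f ` G)} :: (real ^ 'd \<Rightarrow> real) set" and ?E = "\<lambda>f. SUP x\<in>G. f x"
  have space: "sublinear_expectation_space ?H ?E"
    using sublinear_expectation_space_SUP[OF bdd ne] .
  have max: "?E f \<in> f ` G" "\<forall>y\<in>G. f y \<le> ?E f" if f: "f \<in> C_lLip" for f
  proof -
    obtain q where q: "q \<in> G" "\<And>x. x \<in> G \<Longrightarrow> f x \<le> f q"
      using continuous_attains_sup[OF compact ne continuous_on_C_lLip[OF f]] by blast
    then have "?E f = f q" by (intro cSup_eq_maximum) auto
    with q show "?E f \<in> f ` G" "\<forall>y\<in>G. f y \<le> ?E f" by auto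
  qed
  have "random_vector ?H (\<lambda>x. x)"
    using bounded_component_cart[OF bdd] by (simp add: random_vector_def)
  then have "maximal_distributed ?H ?E (\<lambda>x. x)"
    unfolding maximal_distributed_def using bdd closed convex max by blast
  moreover have "sublinear_function ?E (\<lambda>x. x) = g"
  proof
    fix p
    obtain q where "q \<in> G" "p \<bullet> q = g p" using sub by blast
    then have "(SUP x\<in>G. p \<bullet> x) = g p" by (intro cSup_eq_maximum image_eqI[of _ _ q]) (auto simp: G_def)
    then show "sublinear_function ?E (\<lambda>x. x) p = g p" by (simp add: sublinear_function_def)
  qed
  ultimately show ?thesis using space by blast
qed

text \<open>Convergence is asserted for every space carrying a suitable \<open>\<eta>\<close>, and
  the first conjunct provides such a space. For convergence, \<open>G\<close> is the set belonging
  to the given \<open>\<eta>\<close>; both sides are then identified with the maximum of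
  \<open>\<phi>\<close> over \<open>G\<close>.\<close>

theorem theorem3p1:
  fixes H :: "('w \<Rightarrow> real) set" and E :: "('w \<Rightarrow> real) \<Rightarrow> real"
    and Y :: "nat \<Rightarrow> 'w \<Rightarrow> real ^ 'd"
  assumes "sublinear_expectation_space H E"
    and "\<And>i. 1 \<le> i \<Longrightarrow> random_vector H (Y i)"
    and "\<And>i. 1 \<le> i \<Longrightarrow> identically_distributed E (Y (Suc i)) E (Y i)"
    and "\<And>i. 1 \<le> i \<Longrightarrow> independent_of_past E Y i"
  shows "(\<exists>(H' :: (real ^ 'd \<Rightarrow> real) set) E' (\<eta> :: real ^ 'd \<Rightarrow> real ^ 'd).
            sublinear_expectation_space H' E' \<and> maximal_distributed H' E' \<eta> \<and>
            sublinear_function E' \<eta> = sublinear_function E (Y 1)) \<and>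
         (\<forall>(H' :: ('v \<Rightarrow> real) set) E' (\<eta> :: 'v \<Rightarrow> real ^ 'd).
            sublinear_expectation_space H' E' \<and> maximal_distributed H' E' \<eta> \<and>
            sublinear_function E' \<eta> = sublinear_function E (Y 1) \<longrightarrow>
            (\<forall>\<phi> :: real ^ 'd \<Rightarrow> real.
               continuous_on UNIV \<phi> \<and> (\<exists>C. \<forall>x. \<bar>\<phi> x\<bar> \<le> C * (1 + norm x)) \<longrightarrow>
               (\<lambda>n. extended_expectation E (\<lambda>\<omega>. (1 / real n) *\<^sub>R (\<Sum>i=1..n. Y i \<omega>)) \<phi>)
                 \<longlonglongrightarrow> extended_expectation E' \<eta> \<phi>))"
proof (intro conjI allI impI)
  interpret sublinear_expectation_space H E by fact
  let ?g = "sublinear_function E (Y 1)"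
  note inner_H = inner_mem_H[OF assms(2-4)]
  have norm_H: "(\<lambda>\<omega>. norm (Y 1 \<omega>)) \<in> H"
    using H_comp_random_vector[OF assms(2) C_lLip_norm] by simp
  show "\<exists>(H' :: (real ^ 'd \<Rightarrow> real) set) E' (\<eta> :: real ^ 'd \<Rightarrow> real ^ 'd).
      sublinear_expectation_space H' E' \<and> maximal_distributed H' E' \<eta> \<and> sublinear_function E' \<eta> = ?g"
  proof (rule ex_maximal_distributed)
    show "?g (p + q) \<le> ?g p + ?g q" for p q
      using E_subadd[OF inner_H[of p] inner_H[of q]] by (simp add: sublinear_function_def inner_add_left)
    show "?g (c *\<^sub>R p) = c * ?g p" if "0 \<le> c" for c p
      using E_pos_homogeneous[OF inner_H[of p] that] by (simp add: sublinear_function_def)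
    show "?g p \<le> E (\<lambda>\<omega>. norm (Y 1 \<omega>)) * norm p" for p
    proof -
      have "?g p \<le> E (\<lambda>\<omega>. norm p * norm (Y 1 \<omega>))"
        unfolding sublinear_function_def
        by (intro E_mono inner_H H_scale norm_H norm_cauchy_schwarz)
      then show ?thesis using E_pos_homogeneous[OF norm_H, of "norm p"] by (simp add: mult.commute)
    qed
  qed
next
  interpret sublinear_expectation_space H E by fact
  fix H' :: "('v \<Rightarrow> real) set" and E' and \<eta> :: "'v \<Rightarrow> real ^ 'd" and \<phi> :: "real ^ 'd \<Rightarrow> real"
  assume \<eta>: "sublinear_expectation_space H' E' \<and> maximal_distributed H' E' \<eta> \<and>
      sublinear_function E' \<eta> = sublinear_function E (Y 1)"
    and \<phi>: "continuous_on UNIV \<phi> \<and> (\<exists>C. \<forall>x. \<bar>\<phi> x\<bar> \<le> C * (1 + norm x))"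
  interpret \<eta>: sublinear_expectation_space H' E' using \<eta> by blast
  obtain C where cont: "continuous_on UNIV \<phi>" and growth: "\<And>x. \<bar>\<phi> x\<bar> \<le> C * (1 + norm x)"
    using \<phi> by blast
  obtain G where rv: "random_vector H' \<eta>" and G: "bounded G" "closed G" "convex G"
    and max: "\<And>\<psi>. \<psi> \<in> C_lLip \<Longrightarrow> E' (\<lambda>\<omega>. \<psi> (\<eta> \<omega>)) \<in> \<psi> ` G"
      "\<And>\<psi> y. \<psi> \<in> C_lLip \<Longrightarrow> y \<in> G \<Longrightarrow> \<psi> y \<le> E' (\<lambda>\<omega>. \<psi> (\<eta> \<omega>))"
    using \<eta> unfolding maximal_distributed_def by blast
  have compact: "compact G" using G by (simp add: compact_eq_bounded_closed)
  have "G \<noteq> {}" using max(1)[OF C_lLip_const] by blast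
  then obtain q where q: "q \<in> G" "\<And>x. x \<in> G \<Longrightarrow> \<phi> x \<le> \<phi> q"
    using continuous_attains_sup[OF compact _ continuous_on_subset[OF cont subset_UNIV]] by blast
  have g: "E (\<lambda>\<omega>. p \<bullet> Y 1 \<omega>) = E' (\<lambda>\<omega>. p \<bullet> \<eta> \<omega>)" for p
    using \<eta> by (metis sublinear_function_def)
  \<comment> \<open>Linear functions belong to \<open>C_lLip\<close>, so the maximum property of
    \<open>\<eta>\<close> together with \<open>g\<close> says that \<open>G\<close> has the support
    function of \<open>Y 1\<close>.\<close>
  have lin: "(\<lambda>x. p \<bullet> x) \<in> C_lLip" for p :: "real ^ 'd"
    by (rule C_lLip_linear[OF bounded_linear_inner_right])
  have "(\<lambda>n. extended_expectation E (\<lambda>\<omega>. (1 / real n) *\<^sub>R (\<Sum>i=1..n. Y i \<omega>)) \<phi>) \<longlonglongrightarrow> \<phi> q"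
  proof (rule extended_expectation_mean_tendsto[OF assms(2-4) compact G(3) _ _ cont growth q])
    show "\<exists>b\<in>G. E (\<lambda>\<omega>. p \<bullet> Y 1 \<omega>) \<le> p \<bullet> b" for p using max(1)[OF lin[of p]] g by auto
    show "p \<bullet> x \<le> E (\<lambda>\<omega>. p \<bullet> Y 1 \<omega>)" if "x \<in> G" for p x using max(2)[OF lin that] g by simp
  qed
  moreover have "extended_expectation E' \<eta> \<phi> = \<phi> q"
    by (rule \<eta>.extended_expectation_maximal[OF rv compact max cont growth q])
  ultimately show "(\<lambda>n. extended_expectation E (\<lambda>\<omega>. (1 / real n) *\<^sub>R (\<Sum>i=1..n. Y i \<omega>)) \<phi>)
      \<longlonglongrightarrow> extended_expectation E' \<eta> \<phi>" by simp
qed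

end
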